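(* Let $n\geqslant 2$ and let $\mathcal{C}$ be an idempotent complete additive category, regarded as an exact category $(\mathcal{C},\mathscr{E}^t)$ with the trivial exact structure. Then the stable category $\underline{\mathcal{C}[\epsilon]^n}$ of the Frobenius category $(\mathcal{C}[\epsilon]^n,\mathscr{E}_F^t)$ is the homotopy category $\mathrm{K}(\mathcal{C}[\epsilon]^n)$.
   Context: For an additive category $\mathcal{C}$, the category $\mathcal{C}[\epsilon]^n$ has as objects the pairs $(X,\epsilon_X)$ with $X\in\mathcal{C}$ and $\epsilon_X\in\operatorname{End}_{\mathcal{C}}(X)$, $\epsilon_X^n=0$ ($n$-th differential objects); morphisms $(X,\epsilon_X)\to(Y,\epsilon_Y)$ are morphisms $f:X\to Y$ in $\mathcal{C}$ with $f\epsilon_X=\epsilon_Yf$. $\mathcal{C}$ is idempotent complete if every idempotent $e=e^2\in\operatorname{End}(X)$ factors as $e=\iota\pi$ with $\pi:X\to Y$, $\iota:Y\to X$, $\pi\iota=1_Y$. The trivial exact structure $\mathscr{E}^t$ on $\mathcal{C}$ is the one whose short exact sequences are the split ones. $\mathscr{E}_F^t$ is the class of pairs of composable morphisms $A\to B\to C$ in $\mathcal{C}[\epsilon]^n$ whose image under the forgetful functor $F:\mathcal{C}[\epsilon]^n\to\mathcal{C}$, $(X,\epsilon_X)\mapsto X$, is a split short exact sequence in $\mathcal{C}$. With this exact structure $\mathcal{C}[\epsilon]^n$ is a Frobenius category, i.e. an exact category with enough projectives and enough injectives whose projectives and injectives coincide. The stable category $\underline{\mathcal{B}}$ of a Frobenius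 category $\mathcal{B}$ has the same objects as $\mathcal{B}$ and $\operatorname{Hom}_{\underline{\mathcal{B}}}(A,B)=\operatorname{Hom}_{\mathcal{B}}(A,B)/P(A,B)$, where $P(A,B)$ is the subgroup of morphisms factoring through a projective object of $\mathcal{B}$. A morphism $f:(X,\epsilon_X)\to(Y,\epsilon_Y)$ in $\mathcal{C}[\epsilon]^n$ is null-homotopic if there is a morphism $s:X\to Y$ in $\mathcal{C}$ with $f=\epsilon_Y^{n-1}s+\epsilon_Y^{n-2}s\epsilon_X+\cdots+s\epsilon_X^{n-1}$; write $f\sim g$ if $f-g$ is null-homotopic. The homotopy category $\mathrm{K}(\mathcal{C}[\epsilon]^n)$ has the same objects as $\mathcal{C}[\epsilon]^n$ and $\operatorname{Hom}_{\mathrm{K}(\mathcal{C}[\epsilon]^n)}(X,Y)=\operatorname{Hom}_{\mathcal{C}[\epsilon]^n}(X,Y)/\sim$. *)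

theory Defs
  imports "HOL-Algebra.Coset" "HOL-Algebra.FiniteProduct" "HOL-Library.FuncSet"
begin

text \<open>
  Hom-sets are commutative groups in the sense of HOL-Algebra, which writes them
  multiplicatively: the sum of two morphisms is their group product and the zero morphism is the
  unit of the group. Hom-sets of different pairs of objects may overlap, so composition is indexed
  by objects: \<open>Cmp C X Y Z g f\<close> is the composite of \<open>f : X \<rightarrow> Y\<close> and \<open>g : Y \<rightarrow> Z\<close>.
\<close>

record ('o, 'm) addcat =
  Obj :: "'o set"
  HomG :: "'o \<Rightarrow> 'o \<Rightarrow> 'm monoid"
  Idm :: "'o \<Rightarrow> 'm"
  Cmp :: "'o \<Rightarrow> 'o \<Rightarrow> 'o \<Rightarrow> 'm \<Rightarrow> 'm \<Rightarrow> 'm"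

abbreviation Hom :: "('o, 'm) addcat \<Rightarrow> 'o \<Rightarrow> 'o \<Rightarrow> 'm set"
  where "Hom C X Y \<equiv> carrier (HomG C X Y)"

abbreviation zero_mor :: "('o, 'm) addcat \<Rightarrow> 'o \<Rightarrow> 'o \<Rightarrow> 'm"
  where "zero_mor C X Y \<equiv> \<one>\<^bsub>HomG C X Y\<^esub>"

abbreviation add_mor :: "('o, 'm) addcat \<Rightarrow> 'o \<Rightarrow> 'o \<Rightarrow> 'm \<Rightarrow> 'm \<Rightarrow> 'm"
  where "add_mor C X Y f g \<equiv> f \<otimes>\<^bsub>HomG C X Y\<^esub> g"


section \<open>Additive categories\<close>

definition is_biproduct ::
  "('o, 'm) addcat \<Rightarrow> 'o \<Rightarrow> 'o \<Rightarrow> 'o \<Rightarrow> 'm \<Rightarrow> 'm \<Rightarrow> 'm \<Rightarrow> 'm \<Rightarrow> bool"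
  where "is_biproduct C X Y B i j p q \<longleftrightarrow>
    i \<in> Hom C X B \<and> j \<in> Hom C Y B \<and> p \<in> Hom C B X \<and> q \<in> Hom C B Y \<and>
    Cmp C X B X p i = Idm C X \<and> Cmp C Y B Y q j = Idm C Y \<and>
    Cmp C Y B X p j = zero_mor C Y X \<and> Cmp C X B Y q i = zero_mor C X Y \<and>
    add_mor C B B (Cmp C B X B i p) (Cmp C B Y B j q) = Idm C B"

locale additive_category =
  fixes C :: "('o, 'm) addcat"
  assumes hom_group: "\<lbrakk>X \<in> Obj C; Y \<in> Obj C\<rbrakk> \<Longrightarrow> comm_group (HomG C X Y)"
    and id_closed: "X \<in> Obj C \<Longrightarrow> Idm C X \<in> Hom C X X"
    and cmp_closed:
      "\<lbrakk>X \<in> Obj C; Y \<in> Obj C; Z \<in> Obj C; f \<in> Hom C X Y; g \<in> Hom C Y Z\<rbrakk>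
        \<Longrightarrow> Cmp C X Y Z g f \<in> Hom C X Z"
    and cmp_id_right: "\<lbrakk>X \<in> Obj C; Y \<in> Obj C; f \<in> Hom C X Y\<rbrakk> \<Longrightarrow> Cmp C X X Y f (Idm C X) = f"
    and cmp_id_left: "\<lbrakk>X \<in> Obj C; Y \<in> Obj C; f \<in> Hom C X Y\<rbrakk> \<Longrightarrow> Cmp C X Y Y (Idm C Y) f = f"
    and cmp_assoc:
      "\<lbrakk>W \<in> Obj C; X \<in> Obj C; Y \<in> Obj C; Z \<in> Obj C;
        f \<in> Hom C W X; g \<in> Hom C X Y; h \<in> Hom C Y Z\<rbrakk>
        \<Longrightarrow> Cmp C W X Z (Cmp C X Y Z h g) f = Cmp C W Y Z h (Cmp C W X Y g f)"
    and cmp_add_left: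
      "\<lbrakk>X \<in> Obj C; Y \<in> Obj C; Z \<in> Obj C; f \<in> Hom C X Y; g \<in> Hom C Y Z; g' \<in> Hom C Y Z\<rbrakk>
        \<Longrightarrow> Cmp C X Y Z (add_mor C Y Z g g') f
          = add_mor C X Z (Cmp C X Y Z g f) (Cmp C X Y Z g' f)"
    and cmp_add_right:
      "\<lbrakk>X \<in> Obj C; Y \<in> Obj C; Z \<in> Obj C; f \<in> Hom C X Y; f' \<in> Hom C X Y; g \<in> Hom C Y Z\<rbrakk>
        \<Longrightarrow> Cmp C X Y Z g (add_mor C X Y f f')
          = add_mor C X Z (Cmp C X Y Z g f) (Cmp C X Y Z g f')"
    and zero_object:
      "\<exists>Z\<in>Obj C. \<forall>X\<in>Obj C. Hom C Z X = {zero_mor C Z X} \<and> Hom C X Z = {zero_mor C X Z}"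
    and biproducts:
      "\<lbrakk>X \<in> Obj C; Y \<in> Obj C\<rbrakk> \<Longrightarrow> \<exists>B\<in>Obj C. \<exists>i j p q. is_biproduct C X Y B i j p q"

definition idempotent_complete :: "('o, 'm) addcat \<Rightarrow> bool"
  where "idempotent_complete C \<longleftrightarrow>
    (\<forall>X\<in>Obj C. \<forall>e\<in>Hom C X X. Cmp C X X X e e = e \<longrightarrow>
      (\<exists>Y\<in>Obj C. \<exists>\<pi>\<in>Hom C X Y. \<exists>\<iota>\<in>Hom C Y X.
        e = Cmp C X Y X \<iota> \<pi> \<and> Cmp C Y X Y \<pi> \<iota> = Idm C Y))"


section \<open>Exact and Frobenius categories\<close>

text \<open>A pair of composable morphisms \<open>A \<rightarrow> B \<rightarrow> D\<close> is encoded as \<open>(A, i, B, p, D)\<close>.\<close>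

type_synonym ('o, 'm) pair_seq = "'o \<times> 'm \<times> 'o \<times> 'm \<times> 'o"

definition composable_pairs :: "('o, 'm) addcat \<Rightarrow> ('o, 'm) pair_seq set"
  where "composable_pairs C = {(A, i, B, p, D).
    A \<in> Obj C \<and> B \<in> Obj C \<and> D \<in> Obj C \<and> i \<in> Hom C A B \<and> p \<in> Hom C B D}"

definition is_kernel :: "('o, 'm) addcat \<Rightarrow> 'o \<Rightarrow> 'm \<Rightarrow> 'o \<Rightarrow> 'm \<Rightarrow> 'o \<Rightarrow> bool"
  where "is_kernel C A i B p D \<longleftrightarrow>
    Cmp C A B D p i = zero_mor C A D \<and>
    (\<forall>T\<in>Obj C. \<forall>f\<in>Hom C T B. Cmp C T B D p f = zero_mor C T D \<longrightarrow>
      (\<exists>!g. g \<in> Hom C T A \<and> Cmp C T A B i g = f))"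

definition is_cokernel :: "('o, 'm) addcat \<Rightarrow> 'o \<Rightarrow> 'm \<Rightarrow> 'o \<Rightarrow> 'm \<Rightarrow> 'o \<Rightarrow> bool"
  where "is_cokernel C A i B p D \<longleftrightarrow>
    Cmp C A B D p i = zero_mor C A D \<and>
    (\<forall>T\<in>Obj C. \<forall>f\<in>Hom C B T. Cmp C A B T f i = zero_mor C A T \<longrightarrow>
      (\<exists>!g. g \<in> Hom C D T \<and> Cmp C B D T g p = f))"

definition kernel_cokernel_pairs :: "('o, 'm) addcat \<Rightarrow> ('o, 'm) pair_seq set"
  where "kernel_cokernel_pairs C = {(A, i, B, p, D).
    (A, i, B, p, D) \<in> composable_pairs C \<and> is_kernel C A i B p D \<and> is_cokernel C A i B p D}"

definition is_iso :: "('o, 'm) addcat \<Rightarrow> 'o \<Rightarrow> 'o \<Rightarrow> 'm \<Rightarrow> bool"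
  where "is_iso C X Y f \<longleftrightarrow> f \<in> Hom C X Y \<and>
    (\<exists>g\<in>Hom C Y X. Cmp C X Y X g f = Idm C X \<and> Cmp C Y X Y f g = Idm C Y)"

fun iso_pairs :: "('o, 'm) addcat \<Rightarrow> ('o, 'm) pair_seq \<Rightarrow> ('o, 'm) pair_seq \<Rightarrow> bool"
  where "iso_pairs C (A, i, B, p, D) (A', i', B', p', D') \<longleftrightarrow>
    (\<exists>a b d. is_iso C A A' a \<and> is_iso C B B' b \<and> is_iso C D D' d \<and>
      Cmp C A B B' b i = Cmp C A A' B' i' a \<and>
      Cmp C B D D' d p = Cmp C B B' D' p' b)"

definition inflation :: "('o, 'm) pair_seq set \<Rightarrow> 'o \<Rightarrow> 'o \<Rightarrow> 'm \<Rightarrow> bool"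
  where "inflation E A B i \<longleftrightarrow> (\<exists>p D. (A, i, B, p, D) \<in> E)"

definition deflation :: "('o, 'm) pair_seq set \<Rightarrow> 'o \<Rightarrow> 'o \<Rightarrow> 'm \<Rightarrow> bool"
  where "deflation E B D p \<longleftrightarrow> (\<exists>A i. (A, i, B, p, D) \<in> E)"

text \<open>Square with \<open>i : A \<rightarrow> B\<close>, \<open>f : A \<rightarrow> A'\<close>, \<open>i' : A' \<rightarrow> B'\<close>, \<open>f' : B \<rightarrow> B'\<close>.\<close>

definition is_pushout ::
  "('o, 'm) addcat \<Rightarrow> 'o \<Rightarrow> 'o \<Rightarrow> 'o \<Rightarrow> 'o \<Rightarrow> 'm \<Rightarrow> 'm \<Rightarrow> 'm \<Rightarrow> 'm \<Rightarrow> bool"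
  where "is_pushout C A B A' B' i f i' f' \<longleftrightarrow>
    i' \<in> Hom C A' B' \<and> f' \<in> Hom C B B' \<and>
    Cmp C A B B' f' i = Cmp C A A' B' i' f \<and>
    (\<forall>T\<in>Obj C. \<forall>u\<in>Hom C B T. \<forall>v\<in>Hom C A' T.
      Cmp C A B T u i = Cmp C A A' T v f \<longrightarrow>
      (\<exists>!w. w \<in> Hom C B' T \<and> Cmp C B B' T w f' = u \<and> Cmp C A' B' T w i' = v))"

text \<open>Square with \<open>p : B \<rightarrow> D\<close>, \<open>f : D' \<rightarrow> D\<close>, \<open>p' : B' \<rightarrow> D'\<close>, \<open>f' : B' \<rightarrow> B\<close>.\<close>

definition is_pullback ::
  "('o, 'm) addcat \<Rightarrow> 'o \<Rightarrow> 'o \<Rightarrow> 'o \<Rightarrow> 'o \<Rightarrow> 'm \<Rightarrow> 'm \<Rightarrow> 'm \<Rightarrow> 'm \<Rightarrow> bool"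
  where "is_pullback C B D B' D' p f p' f' \<longleftrightarrow>
    p' \<in> Hom C B' D' \<and> f' \<in> Hom C B' B \<and>
    Cmp C B' B D p f' = Cmp C B' D' D f p' \<and>
    (\<forall>T\<in>Obj C. \<forall>u\<in>Hom C T B. \<forall>v\<in>Hom C T D'.
      Cmp C T B D p u = Cmp C T D' D f v \<longrightarrow>
      (\<exists>!w. w \<in> Hom C T B' \<and> Cmp C T B' B f' w = u \<and> Cmp C T B' D' p' w = v))"

locale exact_category = additive_category +
  fixes E :: "('o, 'm) pair_seq set"
  assumes kernel_cokernel: "E \<subseteq> kernel_cokernel_pairs C"
    and iso_closed: "\<lbrakk>S \<in> E; S' \<in> composable_pairs C; iso_pairs C S S'\<rbrakk> \<Longrightarrow> S' \<in> E"
    and id_inflation: "A \<in> Obj C \<Longrightarrow> inflation E A A (Idm C A)"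
    and id_deflation: "A \<in> Obj C \<Longrightarrow> deflation E A A (Idm C A)"
    and cmp_inflation:
      "\<lbrakk>inflation E X Y f; inflation E Y Z g\<rbrakk> \<Longrightarrow> inflation E X Z (Cmp C X Y Z g f)"
    and cmp_deflation:
      "\<lbrakk>deflation E X Y f; deflation E Y Z g\<rbrakk> \<Longrightarrow> deflation E X Z (Cmp C X Y Z g f)"
    and pushout_inflation:
      "\<lbrakk>inflation E A B i; A' \<in> Obj C; f \<in> Hom C A A'\<rbrakk>
        \<Longrightarrow> \<exists>B'\<in>Obj C. \<exists>i' f'. is_pushout C A B A' B' i f i' f' \<and> inflation E A' B' i'"
    and pullback_deflation:
      "\<lbrakk>deflation E B D p; D' \<in> Obj C; f \<in> Hom C D' D\<rbrakk>
        \<Longrightarrow> \<exists>B'\<in>Obj C. \<exists>p' f'. is_pullback C B D B' D' p f p' f' \<and> deflation E B' D' p'"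

definition projective :: "('o, 'm) addcat \<Rightarrow> ('o, 'm) pair_seq set \<Rightarrow> 'o \<Rightarrow> bool"
  where "projective C E P \<longleftrightarrow> P \<in> Obj C \<and>
    (\<forall>B D p. deflation E B D p \<longrightarrow>
      (\<forall>f\<in>Hom C P D. \<exists>g\<in>Hom C P B. Cmp C P B D p g = f))"

definition injective :: "('o, 'm) addcat \<Rightarrow> ('o, 'm) pair_seq set \<Rightarrow> 'o \<Rightarrow> bool"
  where "injective C E I \<longleftrightarrow> I \<in> Obj C \<and>
    (\<forall>A B i. inflation E A B i \<longrightarrow>
      (\<forall>f\<in>Hom C A I. \<exists>g\<in>Hom C B I. Cmp C A B I g i = f))"

locale frobenius_category = exact_category +
  assumes enough_projectives: "X \<in> Obj C \<Longrightarrow> \<exists>P p. projective C E P \<and> deflation E P X p"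
    and enough_injectives: "X \<in> Obj C \<Longrightarrow> \<exists>I i. injective C E I \<and> inflation E X I i"
    and projective_iff_injective: "projective C E P \<longleftrightarrow> injective C E P"


section \<open>Quotients by ideals of morphisms, and the stable category\<close>

text \<open>
  For a two-sided ideal \<open>N\<close> of morphisms of \<open>C\<close> (a subgroup of each hom-group, stable under
  composition on both sides), the composite of two cosets is the coset of the composite of any
  representatives; the union below is over all choices of representatives, which all give the same
  coset. Outside the objects of \<open>C\<close> the components take an arbitrary fixed value
  (by \<^const>\<open>restrict\<close>), so that equality of such records is equality of categories.
\<close>

definition quotient_category ::
  "('o, 'm) addcat \<Rightarrow> ('o \<Rightarrow> 'o \<Rightarrow> 'm set) \<Rightarrow> ('o, 'm set) addcat"
  where "quotient_category C N = \<lparr>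
    Obj = Obj C,
    HomG = (\<lambda>X\<in>Obj C. \<lambda>Y\<in>Obj C. HomG C X Y Mod N X Y),
    Idm = (\<lambda>X\<in>Obj C. N X X #>\<^bsub>HomG C X X\<^esub> Idm C X),
    Cmp = (\<lambda>X\<in>Obj C. \<lambda>Y\<in>Obj C. \<lambda>Z\<in>Obj C. \<lambda>G F.
      \<Union>g\<in>G. \<Union>f\<in>F. N X Z #>\<^bsub>HomG C X Z\<^esub> Cmp C X Y Z g f)\<rparr>"

definition through_projective ::
  "('o, 'm) addcat \<Rightarrow> ('o, 'm) pair_seq set \<Rightarrow> 'o \<Rightarrow> 'o \<Rightarrow> 'm set"
  where "through_projective C E A B = {f \<in> Hom C A B.
    \<exists>P. projective C E P \<and> (\<exists>g\<in>Hom C A P. \<exists>h\<in>Hom C P B. f = Cmp C A P B h g)}"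

definition stable_category ::
  "('o, 'm) addcat \<Rightarrow> ('o, 'm) pair_seq set \<Rightarrow> ('o, 'm set) addcat"
  where "stable_category C E = quotient_category C (through_projective C E)"


section \<open>Differential objects and their homotopy category\<close>

definition End_monoid :: "('o, 'm) addcat \<Rightarrow> 'o \<Rightarrow> 'm monoid"
  where "End_monoid C X = \<lparr>carrier = Hom C X X, mult = Cmp C X X X, one = Idm C X\<rparr>"

abbreviation mor_pow :: "('o, 'm) addcat \<Rightarrow> 'o \<Rightarrow> 'm \<Rightarrow> nat \<Rightarrow> 'm"
  where "mor_pow C X e k \<equiv> e [^]\<^bsub>End_monoid C X\<^esub> k"

definition diff_category :: "('o, 'm) addcat \<Rightarrow> nat \<Rightarrow> ('o \<times> 'm, 'm) addcat"
  where "diff_category C n = \<lparr>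
    Obj = {(X, e). X \<in> Obj C \<and> e \<in> Hom C X X \<and> mor_pow C X e n = zero_mor C X X},
    HomG = (\<lambda>(X, e) (Y, e'). (HomG C X Y)
      \<lparr>carrier := {f \<in> Hom C X Y. Cmp C X X Y f e = Cmp C X Y Y e' f}\<rparr>),
    Idm = (\<lambda>(X, e). Idm C X),
    Cmp = (\<lambda>(X, _) (Y, _) (Z, _). Cmp C X Y Z)\<rparr>"

definition split_pairs :: "('o, 'm) addcat \<Rightarrow> ('o, 'm) pair_seq set"
  where "split_pairs C = {(A, i, B, p, D).
    (A, i, B, p, D) \<in> composable_pairs C \<and> (\<exists>r s. is_biproduct C A D B i s r p)}"

text \<open>The forgetful functor is \<^const>\<open>fst\<close> on objects and the identity on morphisms.\<close>

definition lifted_pairs ::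
  "('o, 'm) addcat \<Rightarrow> nat \<Rightarrow> ('o, 'm) pair_seq set \<Rightarrow> ('o \<times> 'm, 'm) pair_seq set"
  where "lifted_pairs C n E = {(A, i, B, p, D).
    (A, i, B, p, D) \<in> composable_pairs (diff_category C n) \<and>
    (fst A, i, fst B, p, fst D) \<in> E}"

text \<open>\<^const>\<open>finprod\<close> is the sum in the multiplicatively written hom-group.\<close>

fun null_homotopic :: "('o, 'm) addcat \<Rightarrow> nat \<Rightarrow> 'o \<times> 'm \<Rightarrow> 'o \<times> 'm \<Rightarrow> 'm set"
  where "null_homotopic C n (X, e) (Y, e') = {f \<in> Hom (diff_category C n) (X, e) (Y, e').
    \<exists>s\<in>Hom C X Y. f = finprod (HomG C X Y)
      (\<lambda>k. Cmp C X Y Y (mor_pow C Y e' (n - 1 - k)) (Cmp C X X Y s (mor_pow C X e k))) {..<n}}"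

definition homotopy_category :: "('o, 'm) addcat \<Rightarrow> nat \<Rightarrow> ('o \<times> 'm, 'm set) addcat"
  where "homotopy_category C n = quotient_category (diff_category C n) (null_homotopic C n)"

end

theory Submission
  imports Defs
begin

text \<open>
  Call the sum \<open>N(s) = \<Sum>k<n. \<epsilon>\<^sub>B\<^sup>n\<^sup>-\<^sup>1\<^sup>-\<^sup>k s \<epsilon>\<^sub>A\<^sup>k\<close> attached to a morphism \<open>s : A \<rightarrow> B\<close> of \<open>C\<close> the
  homotopy sum of \<open>s\<close>, so that the null-homotopic morphisms are exactly the homotopy sums. Two facts
  carry the proof: \<open>N(s)\<close> always commutes with the differentials (the two composites telescope to the
  same sum since \<open>\<epsilon>\<^sup>n = 0\<close>), and \<open>N\<close> is natural, that is \<open>g N(s) f = N(g s f)\<close> for morphisms \<open>f\<close>, \<open>g\<close>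
  of differential objects.

  The projective objects, and likewise the injective ones, are the contractible objects, those with
  \<open>1 = N(s)\<close> for some \<open>s\<close>; this is the analogue of Higman's criterion in representation theory. If
  \<open>1\<^sub>P = N(s)\<close> and \<open>p : B \<rightarrow> W\<close> has a section \<open>t\<close> in \<open>C\<close>, then a morphism \<open>f : P \<rightarrow> W\<close> lifts to
  \<open>N(t f s)\<close>, because \<open>p N(t f s) = N(f s) = f N(s) = f\<close>; extension along inflations is dual.
  Conversely every object \<open>A\<close> is both a quotient and a subobject of a contractible one, namely the
  truncated polynomial object \<open>A[\<epsilon>]/\<epsilon>\<^sup>n\<close>, and a retract of a contractible object is contractible.
  Hence there are enough projectives and injectives and they coincide.

  The same calculation compares the two ideals. If \<open>f = h g\<close> passes through a projective \<open>P\<close> with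
  \<open>1\<^sub>P = N(s)\<close>, then \<open>f = h N(s) g = N(h s g)\<close>. If \<open>f = N(s) : A \<rightarrow> B\<close>, choose an inflation
  \<open>i : A \<rightarrow> P\<close> into a contractible object, with retraction \<open>r\<close> in \<open>C\<close>; then \<open>f = N(s r i) = N(s r) i\<close>.

  For the axioms of an exact category, the splitting of idempotents gives a criterion that involves
  \<open>C\<close> only: a morphism of differential objects is an inflation as soon as it has a retraction in \<open>C\<close>
  (lemma \<open>inflation_iff_split_mono\<close>). Pushouts are then cokernels of inflations into a direct sum, and
  pullbacks of deflations follow by passing to the opposite category.
\<close>

section \<open>Calculating with morphisms\<close>

lemma is_biproductD:
  assumes "is_biproduct C X Y B i j p q"
  shows "i \<in> Hom C X B" "j \<in> Hom C Y B" "p \<in> Hom C B X" "q \<in> Hom C B Y"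
    "Cmp C X B X p i = Idm C X" "Cmp C Y B Y q j = Idm C Y"
    "Cmp C Y B X p j = zero_mor C Y X" "Cmp C X B Y q i = zero_mor C X Y"
    "add_mor C B B (Cmp C B X B i p) (Cmp C B Y B j q) = Idm C B"
  using assms by (simp_all add: is_biproduct_def)

context additive_category
begin

lemmas hom_comm_monoid = hom_group[THEN comm_group.axioms(1)]
lemmas hom_is_group = hom_group[THEN comm_group.axioms(2)]
lemmas hom_monoid = hom_is_group[THEN group.is_monoid]

declare id_closed [simp] cmp_closed [simp] cmp_id_right [simp] cmp_id_left [simp] cmp_assoc [simp]

lemma zero_closed [simp]: "\<lbrakk>X \<in> Obj C; Y \<in> Obj C\<rbrakk> \<Longrightarrow> zero_mor C X Y \<in> Hom C X Y"
  by (rule monoid.one_closed[OF hom_monoid])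

lemma add_closed [simp]:
  "\<lbrakk>X \<in> Obj C; Y \<in> Obj C; f \<in> Hom C X Y; g \<in> Hom C X Y\<rbrakk> \<Longrightarrow> add_mor C X Y f g \<in> Hom C X Y"
  by (rule monoid.m_closed[OF hom_monoid])

lemma neg_closed [simp]:
  "\<lbrakk>X \<in> Obj C; Y \<in> Obj C; f \<in> Hom C X Y\<rbrakk> \<Longrightarrow> inv\<^bsub>HomG C X Y\<^esub> f \<in> Hom C X Y"
  by (rule group.inv_closed[OF hom_is_group])

lemma add_zero_left [simp]:
  "\<lbrakk>X \<in> Obj C; Y \<in> Obj C; f \<in> Hom C X Y\<rbrakk> \<Longrightarrow> add_mor C X Y (zero_mor C X Y) f = f"
  by (rule monoid.l_one[OF hom_monoid])

lemma add_zero_right [simp]: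
  "\<lbrakk>X \<in> Obj C; Y \<in> Obj C; f \<in> Hom C X Y\<rbrakk> \<Longrightarrow> add_mor C X Y f (zero_mor C X Y) = f"
  by (rule monoid.r_one[OF hom_monoid])

lemma add_commute:
  "\<lbrakk>X \<in> Obj C; Y \<in> Obj C; f \<in> Hom C X Y; g \<in> Hom C X Y\<rbrakk> \<Longrightarrow> add_mor C X Y f g = add_mor C X Y g f"
  by (rule comm_monoid.m_comm[OF hom_comm_monoid])

lemma add_neg_right [simp]:
  "\<lbrakk>X \<in> Obj C; Y \<in> Obj C; f \<in> Hom C X Y\<rbrakk>
    \<Longrightarrow> add_mor C X Y f (inv\<^bsub>HomG C X Y\<^esub> f) = zero_mor C X Y"
  by (rule group.r_inv[OF hom_is_group])

lemma add_neg_cancel [simp]: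
  "\<lbrakk>X \<in> Obj C; Y \<in> Obj C; f \<in> Hom C X Y; g \<in> Hom C X Y\<rbrakk>
    \<Longrightarrow> add_mor C X Y f (add_mor C X Y (inv\<^bsub>HomG C X Y\<^esub> f) g) = g"
  using hom_is_group[of X Y] by (simp add: monoid.m_assoc[OF hom_monoid[of X Y], symmetric])

lemma add_eq_left_iff [simp]:
  assumes "X \<in> Obj C" "Y \<in> Obj C" "f \<in> Hom C X Y" "g \<in> Hom C X Y"
  shows "f = add_mor C X Y f g \<longleftrightarrow> g = zero_mor C X Y"
  using assms group.l_cancel_one'[OF hom_is_group[of X Y]] by simp

lemma add_neg_eq_zero_iff:
  assumes "X \<in> Obj C" "Y \<in> Obj C" "f \<in> Hom C X Y" "g \<in> Hom C X Y"
  shows "add_mor C X Y f (inv\<^bsub>HomG C X Y\<^esub> g) = zero_mor C X Y \<longleftrightarrow> f = g"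
  using assms group.inv_solve_right'[OF hom_is_group[of X Y], of "zero_mor C X Y" f g] by auto

lemma cmp_zero_right [simp]:
  assumes "X \<in> Obj C" "Y \<in> Obj C" "Z \<in> Obj C" "f \<in> Hom C Y Z"
  shows "Cmp C X Y Z f (zero_mor C X Y) = zero_mor C X Z"
  using cmp_add_right[of X Y Z "zero_mor C X Y" "zero_mor C X Y" f] assms by simp

lemma cmp_zero_left [simp]:
  assumes "X \<in> Obj C" "Y \<in> Obj C" "Z \<in> Obj C" "f \<in> Hom C X Y"
  shows "Cmp C X Y Z (zero_mor C Y Z) f = zero_mor C X Z"
  using cmp_add_left[of X Y Z f "zero_mor C Y Z" "zero_mor C Y Z"] assms by simp

lemma cmp_neg_right:
  assumes "X \<in> Obj C" "Y \<in> Obj C" "Z \<in> Obj C" "f \<in> Hom C X Y" "g \<in> Hom C Y Z"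
  shows "Cmp C X Y Z g (inv\<^bsub>HomG C X Y\<^esub> f) = inv\<^bsub>HomG C X Z\<^esub> (Cmp C X Y Z g f)"
proof -
  have "add_mor C X Z (Cmp C X Y Z g (inv\<^bsub>HomG C X Y\<^esub> f)) (Cmp C X Y Z g f)
      = Cmp C X Y Z g (add_mor C X Y (inv\<^bsub>HomG C X Y\<^esub> f) f)"
    using assms by (simp add: cmp_add_right)
  also have "\<dots> = zero_mor C X Z"
    using assms group.l_inv[OF hom_is_group[of X Y]] by simp
  finally show ?thesis
    using assms group.inv_equality[OF hom_is_group[of X Z]] by simp
qed

text \<open>
  Composites are normalized by associating to the right, where an equation for \<open>g \<circ> f\<close> is met in the
  form \<open>g \<circ> (f \<circ> u)\<close>.
\<close>

lemma cmp_rewrite_prefix: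
  assumes "Cmp C X Y Z g f = h"
    and "W \<in> Obj C" "X \<in> Obj C" "Y \<in> Obj C" "Z \<in> Obj C"
    and "f \<in> Hom C X Y" "g \<in> Hom C Y Z" "u \<in> Hom C W X"
  shows "Cmp C W Y Z g (Cmp C W X Y f u) = Cmp C W X Z h u"
  using assms cmp_assoc[of W X Y Z u f g] by simp

lemma is_biproduct_swap:
  assumes "is_biproduct C X Y B i j p q" "X \<in> Obj C" "Y \<in> Obj C" "B \<in> Obj C"
  shows "is_biproduct C Y X B j i q p"
  using assms add_commute[of B B "Cmp C B X B i p" "Cmp C B Y B j q"]
  by (simp add: is_biproduct_def)

lemma biproduct_prefix:
  assumes "is_biproduct C X Y B i j p q" "X \<in> Obj C" "Y \<in> Obj C" "B \<in> Obj C" "W \<in> Obj C"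
  shows "u \<in> Hom C W X \<Longrightarrow> Cmp C W B X p (Cmp C W X B i u) = u"
    "v \<in> Hom C W Y \<Longrightarrow> Cmp C W B Y q (Cmp C W Y B j v) = v"
    "v \<in> Hom C W Y \<Longrightarrow> Cmp C W B X p (Cmp C W Y B j v) = zero_mor C W X"
    "u \<in> Hom C W X \<Longrightarrow> Cmp C W B Y q (Cmp C W X B i u) = zero_mor C W Y"
  using assms is_biproductD[OF assms(1)]
  by (simp_all add: cmp_rewrite_prefix[OF is_biproductD(5)[OF assms(1)]]
    cmp_rewrite_prefix[OF is_biproductD(6)[OF assms(1)]]
    cmp_rewrite_prefix[OF is_biproductD(7)[OF assms(1)]]
    cmp_rewrite_prefix[OF is_biproductD(8)[OF assms(1)]])

lemma biproduct_expand_source: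
  assumes "is_biproduct C X Y B i j p q" "X \<in> Obj C" "Y \<in> Obj C" "B \<in> Obj C"
    and "T \<in> Obj C" "f \<in> Hom C B T"
  shows "add_mor C B T (Cmp C B X T (Cmp C X B T f i) p) (Cmp C B Y T (Cmp C Y B T f j) q) = f"
proof -
  note [simp] = is_biproductD(1-4)[OF assms(1)]
  have "f = Cmp C B B T f (add_mor C B B (Cmp C B X B i p) (Cmp C B Y B j q))"
    using assms is_biproductD(9)[OF assms(1)] by simp
  then show ?thesis
    using assms(2-) by (simp add: cmp_add_right)
qed

lemma biproduct_source_eqI:
  assumes "is_biproduct C X Y B i j p q" "X \<in> Obj C" "Y \<in> Obj C" "B \<in> Obj C" "T \<in> Obj C"
    and "f \<in> Hom C B T" "g \<in> Hom C B T"
    and "Cmp C X B T f i = Cmp C X B T g i" "Cmp C Y B T f j = Cmp C Y B T g j"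
  shows "f = g"
  by (rule box_equals[OF _ biproduct_expand_source[OF assms(1-6)]
        biproduct_expand_source[OF assms(1-5,7)]]) (simp only: assms(8,9))

text \<open>
  A morphism \<open>f\<close> with \<open>f \<circ> i = 0\<close> factors through \<open>p\<close> as \<open>(f \<circ> s) \<circ> p\<close>, by expanding \<open>f\<close> along
  \<open>i \<circ> r + s \<circ> p = 1\<close>.
\<close>

lemma biproduct_cokernel:
  assumes bip: "is_biproduct C A D B i s r p" and [simp]: "A \<in> Obj C" "D \<in> Obj C" "B \<in> Obj C"
  shows "is_cokernel C A i B p D"
  unfolding is_cokernel_def
proof (intro conjI ballI impI)
  note [simp] = is_biproductD(1-8)[OF bip] biproduct_prefix[OF bip]
  show "Cmp C A B D p i = zero_mor C A D" by simp
  fix T f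
  assume [simp]: "T \<in> Obj C" "f \<in> Hom C B T" and fi: "Cmp C A B T f i = zero_mor C A T"
  show "\<exists>!g. g \<in> Hom C D T \<and> Cmp C B D T g p = f"
  proof (rule ex1I[of _ "Cmp C D B T f s"], intro conjI)
    show "Cmp C B D T (Cmp C D B T f s) p = f"
      using biproduct_expand_source[OF bip, of T f] by (simp add: fi del: cmp_assoc)
    fix g assume "g \<in> Hom C D T \<and> Cmp C B D T g p = f"
    then show "g = Cmp C D B T f s" by auto
  qed simp
qed

text \<open>The idempotent \<open>1 - i \<circ> r\<close> splits, and its image is the complement of \<open>A\<close> in \<open>B\<close>.\<close>

lemma split_mono_complement:
  assumes "idempotent_complete C" and [simp]: "A \<in> Obj C" "B \<in> Obj C"
    and [simp]: "i \<in> Hom C A B" "r \<in> Hom C B A" and ri: "Cmp C A B A r i = Idm C A"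
  shows "\<exists>W\<in>Obj C. \<exists>s p. is_biproduct C A W B i s r p"
proof -
  define u where "u = Cmp C B A B i r"
  define e where "e = add_mor C B B (inv\<^bsub>HomG C B B\<^esub> u) (Idm C B)"
  note [simp] = ri cmp_rewrite_prefix[OF ri]
  have [simp]: "u \<in> Hom C B B" "e \<in> Hom C B B" by (simp_all add: u_def e_def)
  have sum: "add_mor C B B u e = Idm C B" by (simp add: e_def)
  have ui: "Cmp C A B B u i = i" and ru: "Cmp C B B A r u = r"
    by (simp_all add: u_def)
  have ei: "Cmp C A B B e i = zero_mor C A B"
    using cmp_add_left[of A B B i u e] ui by (simp add: sum)
  have re: "Cmp C B B A r e = zero_mor C B A"
    using cmp_add_right[of B B A u e r] ru by (simp add: sum)
  have "Cmp C B B B u e = zero_mor C B B"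
    using re by (simp add: u_def)
  then have "Cmp C B B B e e = e"
    using cmp_add_left[of B B B e u e] by (simp add: sum)
  then obtain W p s where [simp]: "W \<in> Obj C" "p \<in> Hom C B W" "s \<in> Hom C W B"
    and e: "e = Cmp C B W B s p" and ps [simp]: "Cmp C W B W p s = Idm C W"
    using assms(1) unfolding idempotent_complete_def by (metis \<open>B \<in> Obj C\<close> \<open>e \<in> Hom C B B\<close>)
  note [simp] = cmp_rewrite_prefix[OF ps]
  have "Cmp C A B W p i = Cmp C A B W p (Cmp C A B B e i)"
    by (simp add: e)
  then have pi: "Cmp C A B W p i = zero_mor C A W" by (simp add: ei)
  have "Cmp C W B A r s = Cmp C W B A (Cmp C B B A r e) s"
    by (simp add: e)
  then have rs: "Cmp C W B A r s = zero_mor C W A" by (simp add: re)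
  have "is_biproduct C A W B i s r p"
    using pi rs sum by (simp add: is_biproduct_def u_def e)
  then show ?thesis by (metis \<open>W \<in> Obj C\<close>)
qed

text \<open>
  The retraction and the section are carried over by conjugation with the isomorphisms.
\<close>

lemma biproduct_transport:
  assumes bip: "is_biproduct C A D B i s r p"
    and [simp]: "A \<in> Obj C" "D \<in> Obj C" "B \<in> Obj C" "A' \<in> Obj C" "D' \<in> Obj C" "B' \<in> Obj C"
    and "is_iso C A A' a" "is_iso C B B' b" "is_iso C D D' d"
    and [simp]: "i' \<in> Hom C A' B'" "p' \<in> Hom C B' D'"
    and ci: "Cmp C A B B' b i = Cmp C A A' B' i' a" and cp: "Cmp C B D D' d p = Cmp C B B' D' p' b"
  shows "\<exists>r' s'. is_biproduct C A' D' B' i' s' r' p'"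
proof -
  note [simp] = is_biproductD(1-8)[OF bip] biproduct_prefix[OF bip]
  obtain a' where [simp]: "a \<in> Hom C A A'" "a' \<in> Hom C A' A"
    and a: "Cmp C A A' A a' a = Idm C A" "Cmp C A' A A' a a' = Idm C A'"
    using \<open>is_iso C A A' a\<close> by (auto simp: is_iso_def)
  obtain b' where [simp]: "b \<in> Hom C B B'" "b' \<in> Hom C B' B"
    and b: "Cmp C B B' B b' b = Idm C B" "Cmp C B' B B' b b' = Idm C B'"
    using \<open>is_iso C B B' b\<close> by (auto simp: is_iso_def)
  obtain d' where [simp]: "d \<in> Hom C D D'" "d' \<in> Hom C D' D"
    and d: "Cmp C D D' D d' d = Idm C D" "Cmp C D' D D' d d' = Idm C D'"
    using \<open>is_iso C D D' d\<close> by (auto simp: is_iso_def)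
  note [simp] = a b d a[THEN cmp_rewrite_prefix] b[THEN cmp_rewrite_prefix] d[THEN cmp_rewrite_prefix]
  have i': "i' = Cmp C A' A B' (Cmp C A B B' b i) a'"
    by (simp add: ci del: cmp_assoc) simp
  have p': "p' = Cmp C B' B D' (Cmp C B D D' d p) b'"
    by (simp add: cp del: cmp_assoc) simp
  have "Cmp C B' B B' b (Cmp C B' B B (add_mor C B B (Cmp C B A B i r) (Cmp C B D B s p)) b')
      = Idm C B'"
    using is_biproductD(9)[OF bip] by simp
  then have "is_biproduct C A' D' B' i' (Cmp C D' B B' b (Cmp C D' D B s d'))
      (Cmp C B' A A' a (Cmp C B' B A r b')) p'"
    by (simp add: is_biproduct_def i' p' cmp_add_left cmp_add_right)
  then show ?thesis by blast
qed

text \<open>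
  A morphism out of the direct sum \<open>S\<close> of \<open>B\<close> and \<open>A'\<close> is a pair \<open>(u, v)\<close>, and it kills the
  difference of the two legs exactly if \<open>u \<circ> i = v \<circ> f\<close>. So the cokernel of the difference represents
  the functor that defines the pushout.
\<close>

lemma pushout_of_cokernel:
  assumes bip: "is_biproduct C B A' S j k p q"
    and [simp]: "A \<in> Obj C" "B \<in> Obj C" "A' \<in> Obj C" "S \<in> Obj C" "B' \<in> Obj C"
    and [simp]: "i \<in> Hom C A B" "f \<in> Hom C A A'" "c \<in> Hom C S B'"
    and cok: "is_cokernel C A
      (add_mor C A S (Cmp C A B S j i) (inv\<^bsub>HomG C A S\<^esub> (Cmp C A A' S k f))) S c B'"
  shows "is_pushout C A B A' B' i f (Cmp C A' S B' c k) (Cmp C B S B' c j)"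
proof -
  note [simp] = is_biproductD(1-8)[OF bip] biproduct_prefix[OF bip]
  let ?m = "add_mor C A S (Cmp C A B S j i) (inv\<^bsub>HomG C A S\<^esub> (Cmp C A A' S k f))"
  have kill: "Cmp C A S T h ?m = zero_mor C A T \<longleftrightarrow>
      Cmp C A B T (Cmp C B S T h j) i = Cmp C A A' T (Cmp C A' S T h k) f"
    if "T \<in> Obj C" "h \<in> Hom C S T" for T h
    using that by (simp add: cmp_add_right cmp_neg_right add_neg_eq_zero_iff)
  show ?thesis
    unfolding is_pushout_def
  proof (intro conjI ballI impI)
    show "Cmp C A B B' (Cmp C B S B' c j) i = Cmp C A A' B' (Cmp C A' S B' c k) f"
      using cok kill[of B' c] by (simp add: is_cokernel_def del: cmp_assoc)
    fix T u v
    assume [simp]: "T \<in> Obj C" "u \<in> Hom C B T" "v \<in> Hom C A' T"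
      and uv: "Cmp C A B T u i = Cmp C A A' T v f"
    define h where "h = add_mor C S T (Cmp C S B T u p) (Cmp C S A' T v q)"
    have h [simp]: "h \<in> Hom C S T" "Cmp C B S T h j = u" "Cmp C A' S T h k = v"
      by (simp_all add: h_def cmp_add_left)
    have "Cmp C A S T h ?m = zero_mor C A T"
      using kill[of T h] uv by (simp del: cmp_assoc)
    then have "\<exists>!w. w \<in> Hom C B' T \<and> Cmp C S B' T w c = h"
      using cok by (simp add: is_cokernel_def)
    moreover have "w \<in> Hom C B' T \<and> Cmp C S B' T w c = h \<longleftrightarrow> w \<in> Hom C B' T \<and>
        Cmp C B B' T w (Cmp C B S B' c j) = u \<and> Cmp C A' B' T w (Cmp C A' S B' c k) = v" for w
    proof (cases "w \<in> Hom C B' T")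
      case True
      then have wc: "Cmp C S B' T w c \<in> Hom C S T"
        by simp
      have "Cmp C S B' T w c = h \<longleftrightarrow>
          Cmp C B S T (Cmp C S B' T w c) j = u \<and> Cmp C A' S T (Cmp C S B' T w c) k = v"
      proof
        assume "Cmp C S B' T w c = h"
        then show "Cmp C B S T (Cmp C S B' T w c) j = u \<and> Cmp C A' S T (Cmp C S B' T w c) k = v"
          by (simp only: h)
      next
        assume "Cmp C B S T (Cmp C S B' T w c) j = u \<and> Cmp C A' S T (Cmp C S B' T w c) k = v"
        then show "Cmp C S B' T w c = h"
          using biproduct_source_eqI[OF bip, of T "Cmp C S B' T w c" h] wc
          by (simp del: cmp_assoc)
      qed
      then show ?thesis
        using True by simp
    qed simp
    ultimately show "\<exists>!w. w \<in> Hom C B' T \<and> Cmp C B B' T w (Cmp C B S B' c j) = u \<and>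
        Cmp C A' B' T w (Cmp C A' S B' c k) = v"
      by (simp only:)
  qed simp_all
qed

end

section \<open>The opposite category\<close>

text \<open>
  Inflations and deflations, kernels and cokernels, pushouts and pullbacks are interchanged by passing
  to the opposite category, and the construction of differential objects commutes with it, so
  that kernels, pullbacks and the splitting criterion for deflations come from their duals.
\<close>

definition op_cat :: "('o, 'm) addcat \<Rightarrow> ('o, 'm) addcat"
  where "op_cat C = \<lparr>
    Obj = Obj C,
    HomG = (\<lambda>X Y. HomG C Y X),
    Idm = Idm C,
    Cmp = (\<lambda>X Y Z g f. Cmp C Z Y X f g)\<rparr>"

lemma op_cat_simps [simp]:
  "Obj (op_cat C) = Obj C" "HomG (op_cat C) X Y = HomG C Y X"
  "Idm (op_cat C) = Idm C" "Cmp (op_cat C) X Y Z g f = Cmp C Z Y X f g"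
  by (simp_all add: op_cat_def)

lemma is_biproduct_op: "is_biproduct (op_cat C) X Y B i j p q \<longleftrightarrow> is_biproduct C X Y B p q i j"
  by (auto simp: is_biproduct_def)

lemma is_cokernel_op: "is_cokernel (op_cat C) A i B p D \<longleftrightarrow> is_kernel C D p B i A"
  by (simp add: is_cokernel_def is_kernel_def)

lemma is_pushout_op:
  "is_pushout (op_cat C) D B D' B' p f p' f' \<longleftrightarrow> is_pullback C B D B' D' p f p' f'"
  by (simp add: is_pushout_def is_pullback_def)

lemma idempotent_complete_op: "idempotent_complete C \<Longrightarrow> idempotent_complete (op_cat C)"
  unfolding idempotent_complete_def by simp metis

lemma (in additive_category) additive_op: "additive_category (op_cat C)"
proof (rule additive_category.intro)
  fix X Y assume XY: "X \<in> Obj (op_cat C)" "Y \<in> Obj (op_cat C)"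
  then show "\<exists>B\<in>Obj (op_cat C). \<exists>i j p q. is_biproduct (op_cat C) X Y B i j p q"
    using biproducts[of X Y] by (simp add: is_biproduct_op) blast
next
  show "\<exists>Z\<in>Obj (op_cat C). \<forall>X\<in>Obj (op_cat C).
      Hom (op_cat C) Z X = {zero_mor (op_cat C) Z X} \<and> Hom (op_cat C) X Z = {zero_mor (op_cat C) X Z}"
    using zero_object by auto
qed (simp_all add: hom_group cmp_add_left cmp_add_right)

lemma (in additive_category) cmp_neg_left:
  assumes "X \<in> Obj C" "Y \<in> Obj C" "Z \<in> Obj C" "f \<in> Hom C X Y" "g \<in> Hom C Y Z"
  shows "Cmp C X Y Z (inv\<^bsub>HomG C Y Z\<^esub> g) f = inv\<^bsub>HomG C X Z\<^esub> (Cmp C X Y Z g f)"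
  using additive_category.cmp_neg_right[OF additive_op, of Z Y X g f] assms by simp


section \<open>Powers of endomorphisms\<close>

lemma End_monoid_simps [simp]:
  "carrier (End_monoid C X) = Hom C X X" "one (End_monoid C X) = Idm C X"
  "mult (End_monoid C X) = Cmp C X X X"
  by (simp_all add: End_monoid_def)

text \<open>Powers are kept folded, to be expanded on either side as needed.\<close>

declare nat_pow_Suc [simp del]

context additive_category
begin

lemma End_is_monoid: "X \<in> Obj C \<Longrightarrow> monoid (End_monoid C X)"
  by (rule monoidI) simp_all

lemma pow_closed [simp]: "\<lbrakk>X \<in> Obj C; e \<in> Hom C X X\<rbrakk> \<Longrightarrow> mor_pow C X e k \<in> Hom C X X"
  using monoid.nat_pow_closed[OF End_is_monoid, of X e k] by simp

lemma pow_Suc: "mor_pow C X e (Suc k) = Cmp C X X X (mor_pow C X e k) e"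
  by (simp add: nat_pow_Suc)

lemma pow_intertwine:
  assumes [simp]: "X \<in> Obj C" "Y \<in> Obj C" "f \<in> Hom C X Y" "e \<in> Hom C X X" "e' \<in> Hom C Y Y"
    and "Cmp C X X Y f e = Cmp C X Y Y e' f"
  shows "Cmp C X X Y f (mor_pow C X e k) = Cmp C X Y Y (mor_pow C Y e' k) f"
proof (induction k)
  case (Suc k)
  have "Cmp C X X Y f (mor_pow C X e (Suc k)) = Cmp C X X Y (Cmp C X X Y f (mor_pow C X e k)) e"
    by (simp add: pow_Suc)
  also have "\<dots> = Cmp C X Y Y (mor_pow C Y e' k) (Cmp C X X Y f e)"
    by (simp add: Suc.IH)
  finally show ?case
    by (simp add: pow_Suc assms(6))
qed simp

lemma pow_Suc_left:
  "\<lbrakk>X \<in> Obj C; e \<in> Hom C X X\<rbrakk> \<Longrightarrow> mor_pow C X e (Suc k) = Cmp C X X X e (mor_pow C X e k)"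
  by (simp add: pow_Suc pow_intertwine[of X X e e e])

lemma pow_op:
  assumes "X \<in> Obj C" "e \<in> Hom C X X"
  shows "mor_pow (op_cat C) X e k = mor_pow C X e k"
proof (induction k)
  case 0
  then show ?case by simp
next
  case (Suc k)
  then show ?case
    using assms additive_category.pow_Suc[OF additive_op] by (simp add: pow_Suc_left)
qed

end


section \<open>The additive category of differential objects\<close>

lemma diff_Obj_iff:
  "A \<in> Obj (diff_category C n) \<longleftrightarrow> fst A \<in> Obj C \<and> snd A \<in> Hom C (fst A) (fst A) \<and>
    mor_pow C (fst A) (snd A) n = zero_mor C (fst A) (fst A)"
  by (auto simp: diff_category_def)

lemma diff_Hom_iff:
  "f \<in> Hom (diff_category C n) A B \<longleftrightarrow> f \<in> Hom C (fst A) (fst B) \<and>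
    Cmp C (fst A) (fst A) (fst B) f (snd A) = Cmp C (fst A) (fst B) (fst B) (snd B) f"
  by (simp add: diff_category_def case_prod_beta)

lemma diff_simps [simp]:
  "Idm (diff_category C n) A = Idm C (fst A)"
  "Cmp (diff_category C n) A B D = Cmp C (fst A) (fst B) (fst D)"
  "zero_mor (diff_category C n) A B = zero_mor C (fst A) (fst B)"
  "add_mor (diff_category C n) A B = add_mor C (fst A) (fst B)"
  by (simp_all add: diff_category_def case_prod_beta fun_eq_iff)

text \<open>
  In this locale \<open>D\<close> is the category \<open>C[\<epsilon>]\<^sup>n\<close> of differential objects and \<open>E\<close> its class of pairs that
  split in \<open>C\<close>. The assumptions are stable under duality.
\<close>

locale nilpotent_differentials = additive_category +
  fixes n :: nat
  assumes idempotents_split: "idempotent_complete C" and n_pos: "0 < n"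
begin

abbreviation "D \<equiv> diff_category C n"
abbreviation "E \<equiv> lifted_pairs C n (split_pairs C)"

lemma diff_ObjD:
  assumes "A \<in> Obj D"
  shows "fst A \<in> Obj C" "snd A \<in> Hom C (fst A) (fst A)"
    "mor_pow C (fst A) (snd A) n = zero_mor C (fst A) (fst A)"
  using assms by (simp_all add: diff_Obj_iff)

lemma diff_HomD:
  assumes "f \<in> Hom D A B"
  shows "f \<in> Hom C (fst A) (fst B)"
    "Cmp C (fst A) (fst A) (fst B) f (snd A) = Cmp C (fst A) (fst B) (fst B) (snd B) f"
  using assms by (simp_all add: diff_Hom_iff)

lemma diff_commute_prefix:
  assumes "f \<in> Hom D A B" "A \<in> Obj D" "B \<in> Obj D" "W \<in> Obj C" "u \<in> Hom C W (fst A)"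
  shows "Cmp C W (fst A) (fst B) f (Cmp C W (fst A) (fst A) (snd A) u)
    = Cmp C W (fst B) (fst B) (snd B) (Cmp C W (fst A) (fst B) f u)"
  using assms cmp_rewrite_prefix[OF diff_HomD(2)[OF assms(1)], of W u]
  by (simp add: diff_Hom_iff diff_Obj_iff)

lemma diff_Hom_subgroup:
  assumes "A \<in> Obj D" "B \<in> Obj D"
  shows "subgroup (Hom D A B) (HomG C (fst A) (fst B))"
proof -
  note [simp] = diff_ObjD[OF assms(1)] diff_ObjD[OF assms(2)]
  show ?thesis
  proof (rule group.subgroupI[OF hom_is_group])
    have "zero_mor C (fst A) (fst B) \<in> Hom D A B" by (simp add: diff_Hom_iff)
    then show "Hom D A B \<noteq> {}" by blast
  qed (auto simp: diff_Hom_iff cmp_neg_left cmp_neg_right cmp_add_left cmp_add_right)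
qed

lemma diff_HomG: "HomG D A B = (HomG C (fst A) (fst B))\<lparr>carrier := Hom D A B\<rparr>"
  by (simp add: diff_category_def case_prod_beta)

lemma diff_hom_group:
  assumes "A \<in> Obj D" "B \<in> Obj D"
  shows "comm_group (HomG D A B)"
proof (subst diff_HomG, rule group.group_comm_groupI)
  show "Group.group ((HomG C (fst A) (fst B))\<lparr>carrier := Hom D A B\<rparr>)"
    by (rule subgroup.subgroup_is_group[OF diff_Hom_subgroup[OF assms]
          hom_is_group[OF diff_ObjD(1)[OF assms(1)] diff_ObjD(1)[OF assms(2)]]])
next
  fix f g
  assume "f \<in> carrier ((HomG C (fst A) (fst B))\<lparr>carrier := Hom D A B\<rparr>)"
    and "g \<in> carrier ((HomG C (fst A) (fst B))\<lparr>carrier := Hom D A B\<rparr>)"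
  then have "f \<in> Hom C (fst A) (fst B)" "g \<in> Hom C (fst A) (fst B)"
    by (simp_all add: diff_Hom_iff)
  then show "f \<otimes>\<^bsub>(HomG C (fst A) (fst B))\<lparr>carrier := Hom D A B\<rparr>\<^esub> g
      = g \<otimes>\<^bsub>(HomG C (fst A) (fst B))\<lparr>carrier := Hom D A B\<rparr>\<^esub> f"
    using add_commute[of "fst A" "fst B" f g] assms by (simp add: diff_ObjD)
qed

lemma diff_neg:
  assumes "A \<in> Obj D" "B \<in> Obj D" "f \<in> Hom D A B"
  shows "inv\<^bsub>HomG D A B\<^esub> f = inv\<^bsub>HomG C (fst A) (fst B)\<^esub> f"
  by (subst diff_HomG, rule group.m_inv_consistent[OF hom_is_group[OF diff_ObjD(1)[OF assms(1)] diff_ObjD(1)[OF assms(2)]]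
        diff_Hom_subgroup[OF assms(1,2)] assms(3)])

lemma diff_biproduct_iff:
  "is_biproduct D A B S i j p q \<longleftrightarrow> i \<in> Hom D A S \<and> j \<in> Hom D B S \<and> p \<in> Hom D S A \<and> q \<in> Hom D S B \<and>
    is_biproduct C (fst A) (fst B) (fst S) i j p q"
  by (auto simp: is_biproduct_def diff_Hom_iff)

text \<open>
  The direct sum carries the diagonal differential \<open>e\<close>. The injections intertwine it with the given
  differentials, so \<open>e\<^sup>n\<close> vanishes on both summands.
\<close>

lemma diff_biproducts:
  assumes A: "A \<in> Obj D" and B: "B \<in> Obj D"
  shows "\<exists>S\<in>Obj D. \<exists>i j p q. is_biproduct D A B S i j p q"
proof -
  note [simp] = diff_ObjD[OF A] diff_ObjD[OF B]
  obtain S i j p q where [simp]: "S \<in> Obj C" and bip: "is_biproduct C (fst A) (fst B) S i j p q"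
    using biproducts[of "fst A" "fst B"] by auto
  note [simp] = is_biproductD(1-8)[OF bip] biproduct_prefix[OF bip]
  define e where "e = add_mor C S S (Cmp C S (fst A) S i (Cmp C S (fst A) (fst A) (snd A) p))
    (Cmp C S (fst B) S j (Cmp C S (fst B) (fst B) (snd B) q))"
  have [simp]: "e \<in> Hom C S S" by (simp add: e_def)
  have i: "Cmp C (fst A) (fst A) S i (snd A) = Cmp C (fst A) S S e i"
    and j: "Cmp C (fst B) (fst B) S j (snd B) = Cmp C (fst B) S S e j"
    by (simp_all add: e_def cmp_add_left)
  have p: "Cmp C S S (fst A) p e = Cmp C S (fst A) (fst A) (snd A) p"
    and q: "Cmp C S S (fst B) q e = Cmp C S (fst B) (fst B) (snd B) q"
    by (simp_all add: e_def cmp_add_right)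
  have "mor_pow C S e n = zero_mor C S S"
  proof (rule biproduct_source_eqI[OF bip])
    show "Cmp C (fst A) S S (mor_pow C S e n) i = Cmp C (fst A) S S (zero_mor C S S) i"
      using pow_intertwine[of "fst A" S i "snd A" e n] i by simp
    show "Cmp C (fst B) S S (mor_pow C S e n) j = Cmp C (fst B) S S (zero_mor C S S) j"
      using pow_intertwine[of "fst B" S j "snd B" e n] j by simp
  qed simp_all
  then have "(S, e) \<in> Obj D" "is_biproduct D A B (S, e) i j p q"
    using bip by (simp_all add: diff_Obj_iff diff_biproduct_iff diff_Hom_iff i j p q)
  then show ?thesis by blast
qed

lemma diff_zero_object:
  "\<exists>Z\<in>Obj D. \<forall>A\<in>Obj D. Hom D Z A = {zero_mor D Z A} \<and> Hom D A Z = {zero_mor D A Z}"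
proof -
  obtain Z where [simp]: "Z \<in> Obj C"
    and Z: "\<And>X. X \<in> Obj C \<Longrightarrow> Hom C Z X = {zero_mor C Z X} \<and> Hom C X Z = {zero_mor C X Z}"
    using zero_object by blast
  have "mor_pow C Z (zero_mor C Z Z) n = zero_mor C Z Z"
    using pow_closed[of Z "zero_mor C Z Z" n] Z[of Z] by simp
  then have "(Z, zero_mor C Z Z) \<in> Obj D" by (simp add: diff_Obj_iff)
  moreover have "Hom D (Z, zero_mor C Z Z) A = {zero_mor D (Z, zero_mor C Z Z) A} \<and>
      Hom D A (Z, zero_mor C Z Z) = {zero_mor D A (Z, zero_mor C Z Z)}" if "A \<in> Obj D" for A
    using that Z[of "fst A"] by (auto simp: diff_Hom_iff diff_Obj_iff)
  ultimately show ?thesis by blast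
qed

lemma diff_additive: "additive_category D"
proof (rule additive_category.intro)
  fix A B S f g
  assume "A \<in> Obj D" "B \<in> Obj D" "S \<in> Obj D" "f \<in> Hom D A B" "g \<in> Hom D B S"
  then show "Cmp D A B S g f \<in> Hom D A S"
    using diff_commute_prefix[of g B S "fst A" f] by (simp add: diff_Hom_iff diff_Obj_iff)
next
  fix A assume "A \<in> Obj D"
  then show "Idm D A \<in> Hom D A A" by (simp add: diff_Hom_iff diff_Obj_iff)
qed (simp_all only: diff_hom_group diff_zero_object diff_biproducts,
    simp_all add: diff_Hom_iff diff_Obj_iff cmp_add_left cmp_add_right)


section \<open>The exact structure of pairs that split after forgetting the differential\<close>

lemma E_iff:
  "(A, i, B, p, W) \<in> E \<longleftrightarrow> A \<in> Obj D \<and> B \<in> Obj D \<and> W \<in> Obj D \<and>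
    i \<in> Hom D A B \<and> p \<in> Hom D B W \<and> (\<exists>r s. is_biproduct C (fst A) (fst W) (fst B) i s r p)"
  by (auto simp: lifted_pairs_def composable_pairs_def split_pairs_def diff_Obj_iff diff_Hom_iff)

text \<open>
  A complement \<open>W\<close> of \<open>A\<close> in \<open>B\<close> exists in \<open>C\<close>, with projection \<open>p\<close> and section \<open>s\<close>. It need not be
  stable under the differential of \<open>B\<close>, but as \<open>A\<close> is stable, \<open>W\<close> is a quotient of \<open>B\<close> as a
  differential object, with the induced differential \<open>p \<circ> \<epsilon>\<^sub>B \<circ> s\<close>; this one is nilpotent because
  \<open>p\<close> is a split epimorphism that intertwines it with \<open>\<epsilon>\<^sub>B\<close>.
\<close>

lemma split_mono_inflation:
  assumes A: "A \<in> Obj D" and B: "B \<in> Obj D" and i: "i \<in> Hom D A B"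
    and "r \<in> Hom C (fst B) (fst A)" "Cmp C (fst A) (fst B) (fst A) r i = Idm C (fst A)"
  shows "inflation E A B i"
proof -
  note [simp] = diff_ObjD[OF A] diff_ObjD[OF B] diff_HomD[OF i]
  obtain W s p where [simp]: "W \<in> Obj C" and bip: "is_biproduct C (fst A) W (fst B) i s r p"
    using split_mono_complement[OF idempotents_split, of "fst A" "fst B" i r] assms(4,5) by auto
  note [simp] = is_biproductD(1-8)[OF bip] biproduct_prefix[OF bip]
  define e where "e = Cmp C W (fst B) W p (Cmp C W (fst B) (fst B) (snd B) s)"
  have [simp]: "e \<in> Hom C W W" by (simp add: e_def)
  have p: "Cmp C (fst B) (fst B) W p (snd B) = Cmp C (fst B) W W e p"
  proof (rule biproduct_source_eqI[OF bip])
    show "Cmp C (fst A) (fst B) W (Cmp C (fst B) (fst B) W p (snd B)) i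
        = Cmp C (fst A) (fst B) W (Cmp C (fst B) W W e p) i"
      using diff_HomD(2)[OF i] by (simp flip: diff_HomD(2)[OF i])
    show "Cmp C W (fst B) W (Cmp C (fst B) (fst B) W p (snd B)) s
        = Cmp C W (fst B) W (Cmp C (fst B) W W e p) s"
      by (simp add: e_def)
  qed simp_all
  have "mor_pow C W e n = Cmp C W (fst B) W (Cmp C (fst B) W W (mor_pow C W e n) p) s"
    by simp
  also have "\<dots> = zero_mor C W W"
    using pow_intertwine[of "fst B" W p "snd B" e n, symmetric] p by (simp del: cmp_assoc)
  finally have "(A, i, B, p, (W, e)) \<in> E"
    using A B i bip p by (auto simp: E_iff diff_Obj_iff diff_Hom_iff)
  then show ?thesis
    unfolding inflation_def by blast
qed

lemma inflation_iff_split_mono: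
  "inflation E A B i \<longleftrightarrow> A \<in> Obj D \<and> B \<in> Obj D \<and> i \<in> Hom D A B \<and>
    (\<exists>r\<in>Hom C (fst B) (fst A). Cmp C (fst A) (fst B) (fst A) r i = Idm C (fst A))"
proof
  assume "inflation E A B i"
  then show "A \<in> Obj D \<and> B \<in> Obj D \<and> i \<in> Hom D A B \<and>
      (\<exists>r\<in>Hom C (fst B) (fst A). Cmp C (fst A) (fst B) (fst A) r i = Idm C (fst A))"
    unfolding inflation_def E_iff by (blast dest: is_biproductD)
qed (use split_mono_inflation in blast)

text \<open>
  Morphisms out of \<open>B\<close> that kill \<open>i\<close> factor uniquely in \<open>C\<close>; the factor commutes with the
  differentials because its composite with the epimorphism \<open>p\<close> does.
\<close>

lemma diff_cokernel:
  assumes "(A, i, B, p, W) \<in> E"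
  shows "is_cokernel D A i B p W"
proof -
  from assms obtain r s where A: "A \<in> Obj D" and B: "B \<in> Obj D" and W: "W \<in> Obj D"
    and i: "i \<in> Hom D A B" and p: "p \<in> Hom D B W"
    and bip: "is_biproduct C (fst A) (fst W) (fst B) i s r p"
    unfolding E_iff by blast
  note [simp] = diff_ObjD[OF A] diff_ObjD[OF B] diff_ObjD[OF W] is_biproductD(1-8)[OF bip]
    biproduct_prefix[OF bip]
  have cok: "is_cokernel C (fst A) i (fst B) p (fst W)"
    by (rule biproduct_cokernel[OF bip]) simp_all
  have descend: "g \<in> Hom D W T"
    if T: "T \<in> Obj D" and g [simp]: "g \<in> Hom C (fst W) (fst T)"
      and gp: "Cmp C (fst B) (fst W) (fst T) g p \<in> Hom D B T" for T g
  proof -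
    note [simp] = diff_ObjD[OF T]
    have "Cmp C (fst W) (fst W) (fst T) g (snd W)
        = Cmp C (fst W) (fst W) (fst T) g (Cmp C (fst W) (fst B) (fst W)
          (Cmp C (fst B) (fst W) (fst W) (snd W) p) s)"
      by simp
    also have "\<dots> = Cmp C (fst W) (fst B) (fst T)
        (Cmp C (fst B) (fst B) (fst T) (Cmp C (fst B) (fst W) (fst T) g p) (snd B)) s"
      by (simp flip: diff_HomD(2)[OF p])
    also have "\<dots> = Cmp C (fst W) (fst T) (fst T) (snd T) g"
      by (simp add: diff_HomD(2)[OF gp] del: cmp_assoc) simp
    finally show ?thesis by (simp add: diff_Hom_iff)
  qed
  show ?thesis
    unfolding is_cokernel_def
  proof (intro conjI ballI impI)
    show "Cmp D A B W p i = zero_mor D A W" by simp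
    fix T f
    assume T: "T \<in> Obj D" and f: "f \<in> Hom D B T" and fi: "Cmp D A B T f i = zero_mor D A T"
    have "\<exists>!g. g \<in> Hom C (fst W) (fst T) \<and> Cmp C (fst B) (fst W) (fst T) g p = f"
      using cok diff_ObjD(1)[OF T] diff_HomD(1)[OF f] fi by (simp add: is_cokernel_def)
    moreover have "g \<in> Hom D W T \<and> Cmp D B W T g p = f \<longleftrightarrow>
        g \<in> Hom C (fst W) (fst T) \<and> Cmp C (fst B) (fst W) (fst T) g p = f" for g
      using descend[OF T, of g] f diff_HomD(1)[of g W T] by auto
    ultimately show "\<exists>!g. g \<in> Hom D W T \<and> Cmp D B W T g p = f"
      by (simp only:)
  qed
qed

text \<open>
  The difference \<open>m\<close> of the two legs is itself split in \<open>C\<close>, by the retraction of \<open>i\<close>, hence an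
  inflation, and its cokernel is the pushout.
\<close>

lemma pushout_of_inflation:
  assumes infl: "inflation E A B i" and A': "A' \<in> Obj D" and f: "f \<in> Hom D A A'"
  shows "\<exists>B'\<in>Obj D. \<exists>i' f'. is_pushout D A B A' B' i f i' f' \<and> inflation E A' B' i'"
proof -
  interpret D: additive_category D by (rule diff_additive)
  obtain r where A: "A \<in> Obj D" and B: "B \<in> Obj D" and i: "i \<in> Hom D A B"
    and r [simp]: "r \<in> Hom C (fst B) (fst A)"
    and ri [simp]: "Cmp C (fst A) (fst B) (fst A) r i = Idm C (fst A)"
    using infl unfolding inflation_iff_split_mono by blast
  obtain S j k p q where S: "S \<in> Obj D" and bipD: "is_biproduct D B A' S j k p q"
    using diff_biproducts[OF B A'] by blast
  have bip: "is_biproduct C (fst B) (fst A') (fst S) j k p q"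
    using bipD by (simp add: diff_biproduct_iff)
  note [simp] = diff_ObjD(1)[OF A] diff_ObjD(1)[OF A'] diff_ObjD(1)[OF B] diff_ObjD(1)[OF S]
    diff_HomD(1)[OF i] diff_HomD(1)[OF f] is_biproductD(1-8)[OF bip] biproduct_prefix[OF bip]
  define m where "m = add_mor D A S (Cmp D A B S j i) (inv\<^bsub>HomG D A S\<^esub> (Cmp D A A' S k f))"
  have jk: "Cmp D A B S j i \<in> Hom D A S" "Cmp D A A' S k f \<in> Hom D A S"
    using D.cmp_closed A A' B S i f is_biproductD(1,2)[OF bipD] by blast+
  have m: "m \<in> Hom D A S"
    unfolding m_def by (intro D.add_closed D.neg_closed A S jk)
  have mC: "m = add_mor C (fst A) (fst S) (Cmp C (fst A) (fst B) (fst S) j i)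
      (inv\<^bsub>HomG C (fst A) (fst S)\<^esub> (Cmp C (fst A) (fst A') (fst S) k f))"
    using diff_neg[OF A S jk(2)] by (simp add: m_def)
  have "Cmp C (fst A) (fst S) (fst A) (Cmp C (fst S) (fst B) (fst A) r p) m = Idm C (fst A)"
    by (simp add: mC cmp_add_right cmp_neg_right monoid.inv_one[OF hom_monoid])
  then have "inflation E A S m"
    by (intro split_mono_inflation[OF A S m, of "Cmp C (fst S) (fst B) (fst A) r p"]) simp_all
  then obtain c B' where mem: "(A, m, S, c, B') \<in> E"
    unfolding inflation_def by blast
  then obtain t s where B': "B' \<in> Obj D" and c: "c \<in> Hom D S B'"
    and bipc: "is_biproduct C (fst A) (fst B') (fst S) m s t c"
    unfolding E_iff by blast
  note [simp] = diff_ObjD(1)[OF B'] diff_HomD(1)[OF c]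
  let ?k = "Cmp C (fst A') (fst S) (fst B') c k" and ?j = "Cmp C (fst B) (fst S) (fst B') c j"
  have poD: "is_pushout D A B A' B' i f ?k ?j"
    using D.pushout_of_cokernel[OF bipD A B A' S B' i f c] diff_cokernel[OF mem]
    by (simp add: m_def)
  \<comment> \<open>The same square is a pushout in \<open>C\<close>, so \<open>f \<circ> r\<close> and the identity of \<open>A'\<close> induce a retraction of \<open>?k\<close>.\<close>
  have poC: "is_pushout C (fst A) (fst B) (fst A') (fst B') i f ?k ?j"
    using biproduct_cokernel[OF bipc]
    by (intro pushout_of_cokernel[OF bip]) (simp_all add: mC)
  have "Cmp C (fst A) (fst B) (fst A') (Cmp C (fst B) (fst A) (fst A') f r) i
      = Cmp C (fst A) (fst A') (fst A') (Idm C (fst A')) f"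
    by simp
  then obtain w where "w \<in> Hom C (fst B') (fst A')"
    "Cmp C (fst A') (fst B') (fst A') w ?k = Idm C (fst A')"
    using poC unfolding is_pushout_def
    by (metis A A' B cmp_closed diff_HomD(1) diff_ObjD(1) f id_closed r)
  moreover have "?k \<in> Hom D A' B'"
    using poD by (simp add: is_pushout_def)
  ultimately have "inflation E A' B' ?k"
    by (intro split_mono_inflation A' B')
  then show ?thesis
    using poD B' by blast
qed

end

lemma (in additive_category) diff_category_op:
  "diff_category (op_cat C) n = op_cat (diff_category C n)"
proof -
  have "{(X, e). X \<in> Obj C \<and> e \<in> Hom C X X \<and> mor_pow (op_cat C) X e n = zero_mor C X X}
      = {(X, e). X \<in> Obj C \<and> e \<in> Hom C X X \<and> mor_pow C X e n = zero_mor C X X}"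
    by (auto simp: pow_op)
  moreover have "{f \<in> Hom C Y X. Cmp C Y X X e f = Cmp C Y Y X f e'}
      = {f \<in> Hom C Y X. Cmp C Y Y X f e' = Cmp C Y X X e f}" for X e Y e'
    by auto
  ultimately show ?thesis
    by (simp add: diff_category_def op_cat_def fun_eq_iff)
qed

text \<open>
  Dualizing exchanges the two summands of the biproduct, which uses the commutativity of addition.
\<close>

lemma split_pairs_op:
  assumes "additive_category C"
  shows "(A, i, B, p, W) \<in> split_pairs (op_cat C) \<longleftrightarrow> (W, p, B, i, A) \<in> split_pairs C"
  using additive_category.is_biproduct_swap[OF assms]
  by (fastforce simp: split_pairs_def composable_pairs_def is_biproduct_op)

lemma (in additive_category) lifted_split_pairs_op:
  "(A, i, B, p, W) \<in> lifted_pairs (op_cat C) n (split_pairs (op_cat C)) \<longleftrightarrow>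
    (W, p, B, i, A) \<in> lifted_pairs C n (split_pairs C)"
  by (auto simp: lifted_pairs_def diff_category_op composable_pairs_def
    split_pairs_op[OF additive_category_axioms])

context nilpotent_differentials
begin

lemma nilpotent_differentials_op: "nilpotent_differentials (op_cat C) n"
  by (intro nilpotent_differentials.intro nilpotent_differentials_axioms.intro additive_op
    idempotent_complete_op idempotents_split n_pos)

lemma inflation_op:
  "inflation (lifted_pairs (op_cat C) n (split_pairs (op_cat C))) A B i \<longleftrightarrow> deflation E B A i"
  by (auto simp: inflation_def deflation_def lifted_split_pairs_op)

lemma deflation_iff_split_epi:
  "deflation E B A p \<longleftrightarrow> A \<in> Obj D \<and> B \<in> Obj D \<and> p \<in> Hom D B A \<and>
    (\<exists>s\<in>Hom C (fst A) (fst B). Cmp C (fst A) (fst B) (fst A) p s = Idm C (fst A))"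
  using nilpotent_differentials.inflation_iff_split_mono[OF nilpotent_differentials_op, of A B p]
  by (simp add: inflation_op diff_category_op)

lemma diff_kernel:
  assumes "(A, i, B, p, W) \<in> E"
  shows "is_kernel D A i B p W"
  using nilpotent_differentials.diff_cokernel[OF nilpotent_differentials_op, of W p B i A] assms
  by (simp add: lifted_split_pairs_op diff_category_op is_cokernel_op)

lemma pullback_of_deflation:
  assumes "deflation E B W p" "W' \<in> Obj D" "f \<in> Hom D W' W"
  shows "\<exists>B'\<in>Obj D. \<exists>p' f'. is_pullback D B W B' W' p f p' f' \<and> deflation E B' W' p'"
  using nilpotent_differentials.pushout_of_inflation[OF nilpotent_differentials_op, of W B p W' f]
    assms
  by (simp add: inflation_op diff_category_op is_pushout_op)

lemma inflation_cmp:
  assumes "inflation E X Y f" "inflation E Y Z g"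
  shows "inflation E X Z (Cmp D X Y Z g f)"
proof -
  interpret D: additive_category D by (rule diff_additive)
  obtain r where X: "X \<in> Obj D" and Y: "Y \<in> Obj D" and f: "f \<in> Hom D X Y"
    and r [simp]: "r \<in> Hom C (fst Y) (fst X)"
    and rf [simp]: "Cmp C (fst X) (fst Y) (fst X) r f = Idm C (fst X)"
    using assms(1) unfolding inflation_iff_split_mono by blast
  obtain t where Z: "Z \<in> Obj D" and g: "g \<in> Hom D Y Z" and t [simp]: "t \<in> Hom C (fst Z) (fst Y)"
    and tg: "Cmp C (fst Y) (fst Z) (fst Y) t g = Idm C (fst Y)"
    using assms(2) unfolding inflation_iff_split_mono by blast
  note [simp] = diff_ObjD(1)[OF X] diff_ObjD(1)[OF Y] diff_ObjD(1)[OF Z]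
    diff_HomD(1)[OF f] diff_HomD(1)[OF g] cmp_rewrite_prefix[OF tg]
  show ?thesis
    using D.cmp_closed[OF X Y Z f g]
    by (intro split_mono_inflation[OF X Z, of _ "Cmp C (fst Z) (fst Y) (fst X) r t"]) simp_all
qed

lemma deflation_cmp:
  assumes "deflation E X Y f" "deflation E Y Z g"
  shows "deflation E X Z (Cmp D X Y Z g f)"
  using nilpotent_differentials.inflation_cmp[OF nilpotent_differentials_op, of Z Y g X f] assms
  by (simp add: inflation_op diff_category_op)

lemma is_iso_forget: "is_iso D A B f \<Longrightarrow> is_iso C (fst A) (fst B) f"
  by (auto simp: is_iso_def diff_Hom_iff)

lemma E_iso_closed:
  assumes "S \<in> E" "S' \<in> composable_pairs D" "iso_pairs D S S'"
  shows "S' \<in> E"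
proof -
  obtain A i B p W where S: "S = (A, i, B, p, W)" by (cases S)
  obtain A' i' B' p' W' where S': "S' = (A', i', B', p', W')" by (cases S')
  obtain r s where ABW: "A \<in> Obj D" "W \<in> Obj D" "B \<in> Obj D"
    and bip: "is_biproduct C (fst A) (fst W) (fst B) i s r p"
    using assms(1) unfolding S E_iff by blast
  have ABW': "A' \<in> Obj D" "W' \<in> Obj D" "B' \<in> Obj D" and ip: "i' \<in> Hom D A' B'" "p' \<in> Hom D B' W'"
    using assms(2) by (auto simp: S' composable_pairs_def)
  obtain a b d where iso: "is_iso D A A' a" "is_iso D B B' b" "is_iso D W W' d"
    and sq: "Cmp D A B B' b i = Cmp D A A' B' i' a" "Cmp D B W W' d p = Cmp D B B' W' p' b"
    using assms(3) unfolding S S' by auto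
  have "\<exists>r' s'. is_biproduct C (fst A') (fst W') (fst B') i' s' r' p'"
    using sq by (intro biproduct_transport[OF bip ABW[THEN diff_ObjD(1)] ABW'[THEN diff_ObjD(1)]
      iso[THEN is_iso_forget] ip[THEN diff_HomD(1)]]) simp_all
  then show ?thesis
    using ABW' ip by (simp add: S' E_iff)
qed

lemma id_inflation: "A \<in> Obj D \<Longrightarrow> inflation E A A (Idm D A)"
  unfolding inflation_iff_split_mono
  by (auto simp: diff_Hom_iff diff_Obj_iff intro!: bexI[of _ "Idm C (fst A)"])

lemma id_deflation: "A \<in> Obj D \<Longrightarrow> deflation E A A (Idm D A)"
  unfolding deflation_iff_split_epi
  by (auto simp: diff_Hom_iff diff_Obj_iff intro!: bexI[of _ "Idm C (fst A)"])

lemma diff_exact: "exact_category D E"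
proof (rule exact_category.intro[OF diff_additive], rule exact_category_axioms.intro)
  show "E \<subseteq> kernel_cokernel_pairs D"
  proof
    fix S assume "S \<in> E"
    moreover obtain A i B p W where "S = (A, i, B, p, W)" by (cases S)
    ultimately show "S \<in> kernel_cokernel_pairs D"
      using diff_kernel[of A i B p W] diff_cokernel[of A i B p W]
      by (simp add: kernel_cokernel_pairs_def composable_pairs_def E_iff)
  qed
qed (fact E_iso_closed id_inflation id_deflation inflation_cmp deflation_cmp
    pushout_of_inflation pullback_of_deflation)+

end


section \<open>Homotopy sums\<close>

text \<open>
  The sum in the definition of null-homotopy, as an operator on all morphisms \<open>s\<close> of the underlying
  category. It plays the role of the transfer (relative trace) of a finite group.
\<close>

definition homotopy_sum ::
  "('o, 'm) addcat \<Rightarrow> nat \<Rightarrow> 'o \<times> 'm \<Rightarrow> 'o \<times> 'm \<Rightarrow> 'm \<Rightarrow> 'm"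
  where "homotopy_sum C n A B s = finprod (HomG C (fst A) (fst B))
    (\<lambda>k. Cmp C (fst A) (fst B) (fst B) (mor_pow C (fst B) (snd B) (n - 1 - k))
      (Cmp C (fst A) (fst A) (fst B) s (mor_pow C (fst A) (snd A) k))) {..<n}"

lemma null_homotopic_iff:
  "f \<in> null_homotopic C n A B \<longleftrightarrow> f \<in> Hom (diff_category C n) A B \<and>
    (\<exists>s\<in>Hom C (fst A) (fst B). f = homotopy_sum C n A B s)"
  by (cases A; cases B) (simp add: homotopy_sum_def)

context additive_category
begin

lemma sum_closed:
  "\<lbrakk>X \<in> Obj C; Y \<in> Obj C; \<And>k. k \<in> K \<Longrightarrow> f k \<in> Hom C X Y\<rbrakk> \<Longrightarrow> finprod (HomG C X Y) f K \<in> Hom C X Y"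
  by (rule comm_monoid.finprod_closed[OF hom_comm_monoid]) auto

lemma sum_cong:
  assumes "X \<in> Obj C" "Y \<in> Obj C" "\<And>k. k \<in> K \<Longrightarrow> g k \<in> Hom C X Y" "\<And>k. k \<in> K \<Longrightarrow> f k = g k"
  shows "finprod (HomG C X Y) f K = finprod (HomG C X Y) g K"
  using assms by (intro comm_monoid.finprod_cong'[OF hom_comm_monoid]) auto

lemma sum_atMost_Suc:
  assumes "X \<in> Obj C" "Y \<in> Obj C" "\<And>k. k \<le> Suc m \<Longrightarrow> f k \<in> Hom C X Y"
  shows "finprod (HomG C X Y) f {..Suc m} = add_mor C X Y (f (Suc m)) (finprod (HomG C X Y) f {..m})"
  using assms by (intro comm_monoid.finprod_Suc[OF hom_comm_monoid]) auto

lemma sum_atMost_Suc_shift: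
  assumes "X \<in> Obj C" "Y \<in> Obj C" "\<And>k. k \<le> Suc m \<Longrightarrow> f k \<in> Hom C X Y"
  shows "finprod (HomG C X Y) f {..Suc m}
    = add_mor C X Y (finprod (HomG C X Y) (\<lambda>k. f (Suc k)) {..m}) (f 0)"
  using assms by (intro comm_monoid.finprod_Suc2[OF hom_comm_monoid]) auto

lemma sum_single:
  assumes "X \<in> Obj C" "Y \<in> Obj C" "finite K" "m \<in> K" "f m \<in> Hom C X Y"
    and "\<And>k. k \<in> K \<Longrightarrow> k \<noteq> m \<Longrightarrow> f k = zero_mor C X Y"
  shows "finprod (HomG C X Y) f K = f m"
proof -
  have "f \<in> K \<rightarrow> Hom C X Y"
  proof
    fix k assume "k \<in> K"
    then show "f k \<in> Hom C X Y" using assms by (cases "k = m") simp_all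
  qed
  then have "(\<Otimes>\<^bsub>HomG C X Y\<^esub>k\<in>K. if m = k then f k else zero_mor C X Y) = f m"
    using assms by (intro comm_monoid.finprod_singleton[OF hom_comm_monoid]) auto
  moreover have "finprod (HomG C X Y) f K = (\<Otimes>\<^bsub>HomG C X Y\<^esub>k\<in>K. if m = k then f k else zero_mor C X Y)"
    using assms by (intro sum_cong) auto
  ultimately show ?thesis by simp
qed

lemma cmp_sum_right:
  assumes "finite K" and [simp]: "X \<in> Obj C" "Y \<in> Obj C" "Z \<in> Obj C" "g \<in> Hom C Y Z"
    and "\<And>k. k \<in> K \<Longrightarrow> f k \<in> Hom C X Y"
  shows "Cmp C X Y Z g (finprod (HomG C X Y) f K) = finprod (HomG C X Z) (\<lambda>k. Cmp C X Y Z g (f k)) K"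
  using assms(1,6)
proof (induction K rule: finite_induct)
  case empty
  then show ?case
    by (simp add: comm_monoid.finprod_empty[OF hom_comm_monoid])
next
  case (insert k K)
  have "finprod (HomG C X Y) f (insert k K) = add_mor C X Y (f k) (finprod (HomG C X Y) f K)"
    using insert.hyps insert.prems
    by (intro comm_monoid.finprod_insert[OF hom_comm_monoid]) auto
  moreover have "finprod (HomG C X Z) (\<lambda>k. Cmp C X Y Z g (f k)) (insert k K)
      = add_mor C X Z (Cmp C X Y Z g (f k)) (finprod (HomG C X Z) (\<lambda>k. Cmp C X Y Z g (f k)) K)"
    using insert.hyps insert.prems
    by (intro comm_monoid.finprod_insert[OF hom_comm_monoid]) auto
  ultimately show ?case
    using insert by (simp add: cmp_add_right sum_closed)
qed

lemma cmp_sum_left: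
  assumes "finite K" "X \<in> Obj C" "Y \<in> Obj C" "Z \<in> Obj C" "g \<in> Hom C X Y"
    and "\<And>k. k \<in> K \<Longrightarrow> f k \<in> Hom C Y Z"
  shows "Cmp C X Y Z (finprod (HomG C Y Z) f K) g = finprod (HomG C X Z) (\<lambda>k. Cmp C X Y Z (f k) g) K"
  using additive_category.cmp_sum_right[OF additive_op, of K Z Y X g f] assms by simp

end

context nilpotent_differentials
begin

text \<open>
  With \<open>h k = \<epsilon>\<^sub>B\<^sup>n\<^sup>-\<^sup>k s \<epsilon>\<^sub>A\<^sup>k\<close>, composing with the differential of \<open>B\<close> gives \<open>h 0 + \<dots> + h (n - 1)\<close>
  and composing with that of \<open>A\<close> gives \<open>h 1 + \<dots> + h n\<close>. The extreme terms \<open>h 0\<close> and \<open>h n\<close> vanish by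
  nilpotency.
\<close>

lemma homotopy_sum_in_diff:
  assumes A: "A \<in> Obj D" and B: "B \<in> Obj D" and s [simp]: "s \<in> Hom C (fst A) (fst B)"
  shows "homotopy_sum C n A B s \<in> Hom D A B"
proof -
  obtain m where m: "n = Suc m" using n_pos by (cases n) auto
  note [simp] = diff_ObjD(1,2)[OF A] diff_ObjD(1,2)[OF B]
  note nil = diff_ObjD(3)[OF A] diff_ObjD(3)[OF B]
  let ?N = "homotopy_sum C n A B s"
  define h where "h k = Cmp C (fst A) (fst B) (fst B) (mor_pow C (fst B) (snd B) (n - k))
    (Cmp C (fst A) (fst A) (fst B) s (mor_pow C (fst A) (snd A) k))" for k
  have h [simp]: "h k \<in> Hom C (fst A) (fst B)" for k
    by (simp add: h_def)
  have ends: "h 0 = zero_mor C (fst A) (fst B)" "h (Suc m) = zero_mor C (fst A) (fst B)"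
    using nil by (simp_all add: h_def m)
  have "Cmp C (fst A) (fst B) (fst B) (snd B) ?N = finprod (HomG C (fst A) (fst B)) h {..m}"
    unfolding homotopy_sum_def m lessThan_Suc_atMost
    by (subst cmp_sum_right, simp_all, rule sum_cong)
      (simp_all add: h_def m Suc_diff_le pow_Suc_left)
  also have "\<dots> = finprod (HomG C (fst A) (fst B)) h {..Suc m}"
    by (simp add: sum_atMost_Suc ends sum_closed)
  also have "\<dots> = finprod (HomG C (fst A) (fst B)) (\<lambda>k. h (Suc k)) {..m}"
    by (simp add: sum_atMost_Suc_shift ends sum_closed)
  also have "\<dots> = Cmp C (fst A) (fst A) (fst B) ?N (snd A)"
    unfolding homotopy_sum_def m lessThan_Suc_atMost
    by (subst cmp_sum_left, simp_all, rule sum_cong)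
      (simp_all add: h_def m pow_Suc)
  finally show ?thesis
    by (simp add: diff_Hom_iff) (simp add: homotopy_sum_def sum_closed)
qed

lemma cmp_homotopy_sum_right:
  assumes A: "A \<in> Obj D" and B: "B \<in> Obj D" and B': "B' \<in> Obj D"
    and [simp]: "s \<in> Hom C (fst A) (fst B)" and g: "g \<in> Hom D B B'"
  shows "Cmp C (fst A) (fst B) (fst B') g (homotopy_sum C n A B s)
    = homotopy_sum C n A B' (Cmp C (fst A) (fst B) (fst B') g s)"
proof -
  note [simp] = diff_ObjD(1,2)[OF A] diff_ObjD(1,2)[OF B] diff_ObjD(1,2)[OF B'] diff_HomD(1)[OF g]
  have "Cmp C W (fst B) (fst B') g (Cmp C W (fst B) (fst B) (mor_pow C (fst B) (snd B) k) u)
      = Cmp C W (fst B') (fst B') (mor_pow C (fst B') (snd B') k) (Cmp C W (fst B) (fst B') g u)"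
    if "W \<in> Obj C" "u \<in> Hom C W (fst B)" for W u k
    using that cmp_rewrite_prefix[OF pow_intertwine, of "fst B" "fst B'" g "snd B" "snd B'" W k u]
      diff_HomD(2)[OF g] by simp
  then show ?thesis
    unfolding homotopy_sum_def by (subst cmp_sum_right) simp_all
qed

lemma cmp_homotopy_sum_left:
  assumes A: "A \<in> Obj D" and A': "A' \<in> Obj D" and B: "B \<in> Obj D"
    and [simp]: "s \<in> Hom C (fst A) (fst B)" and f: "f \<in> Hom D A' A"
  shows "Cmp C (fst A') (fst A) (fst B) (homotopy_sum C n A B s) f
    = homotopy_sum C n A' B (Cmp C (fst A') (fst A) (fst B) s f)"
proof -
  note [simp] = diff_ObjD(1,2)[OF A] diff_ObjD(1,2)[OF A'] diff_ObjD(1,2)[OF B] diff_HomD(1)[OF f]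
  have "Cmp C (fst A') (fst A) (fst A) (mor_pow C (fst A) (snd A) k) f
      = Cmp C (fst A') (fst A') (fst A) f (mor_pow C (fst A') (snd A') k)" for k
    using pow_intertwine[of "fst A'" "fst A" f "snd A'" "snd A" k] diff_HomD(2)[OF f] by simp
  then show ?thesis
    unfolding homotopy_sum_def by (subst cmp_sum_left) simp_all
qed

end


section \<open>Truncated polynomial objects\<close>

text \<open>
  The object \<open>X[\<epsilon>]/\<epsilon>\<^sup>l\<^sup>+\<^sup>1\<close>, that is the direct sum of \<open>l + 1\<close> copies of \<open>X\<close> with the shift as
  differential \<open>e\<close>, described by the inclusion \<open>i\<close> of the constants and the coefficient \<open>q\<close> of
  \<open>\<epsilon>\<^sup>l\<close>. As \<open>e\<^sup>l\<^sup>-\<^sup>k i\<close> is the inclusion of the summand of \<open>\<epsilon>\<^sup>l\<^sup>-\<^sup>k\<close> and \<open>q e\<^sup>k\<close> the projection onto it,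
  the last equation says that the identity is the sum of the projections onto the summands.
  The induction puts a new constant term in front: \<open>X[\<epsilon>]/\<epsilon>\<^sup>l\<^sup>+\<^sup>2\<close> is \<open>X \<oplus> X[\<epsilon>]/\<epsilon>\<^sup>l\<^sup>+\<^sup>1\<close>, the second summand
  being the multiples of \<open>\<epsilon>\<close>.
\<close>

lemma (in additive_category) truncated_polynomial_object:
  assumes [simp]: "X \<in> Obj C"
  shows "\<exists>P e i q. P \<in> Obj C \<and> e \<in> Hom C P P \<and> i \<in> Hom C X P \<and> q \<in> Hom C P X \<and>
    mor_pow C P e (Suc l) = zero_mor C P P \<and>
    (\<forall>k<l. Cmp C X P X q (Cmp C X P P (mor_pow C P e k) i) = zero_mor C X X) \<and>
    Cmp C X P X q (Cmp C X P P (mor_pow C P e l) i) = Idm C X \<and>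
    homotopy_sum C (Suc l) (P, e) (P, e) (Cmp C P X P i q) = Idm C P"
proof (induction l)
  case 0
  have "homotopy_sum C (Suc 0) (X, zero_mor C X X) (X, zero_mor C X X) (Cmp C X X X (Idm C X) (Idm C X))
      = Idm C X"
    using comm_monoid.finprod_0[OF hom_comm_monoid[of X X], of "mor_pow C X (zero_mor C X X)"]
    by (simp add: homotopy_sum_def lessThan_Suc_atMost del: One_nat_def)
  then show ?case
    by (intro exI[of _ X] exI[of _ "zero_mor C X X"] exI[of _ "Idm C X"]) (simp add: pow_Suc)
next
  case (Suc l)
  then obtain P e i q where [simp]: "P \<in> Obj C" "e \<in> Hom C P P" "i \<in> Hom C X P" "q \<in> Hom C P X"
    and nil: "mor_pow C P e (Suc l) = zero_mor C P P"
    and low: "\<And>k. k < l \<Longrightarrow> Cmp C X P X q (Cmp C X P P (mor_pow C P e k) i) = zero_mor C X X"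
    and top: "Cmp C X P X q (Cmp C X P P (mor_pow C P e l) i) = Idm C X"
    and sum: "homotopy_sum C (Suc l) (P, e) (P, e) (Cmp C P X P i q) = Idm C P"
    by blast
  obtain S a j p b where [simp]: "S \<in> Obj C" and bip: "is_biproduct C X P S a j p b"
    using biproducts[of X P] by auto
  note [simp] = is_biproductD(1-8)[OF bip] biproduct_prefix[OF bip]
  \<comment> \<open>Multiplication by \<open>\<epsilon>\<close>: a constant goes to the lowest coefficient in \<open>P\<close>.\<close>
  define e' where "e' = add_mor C S S (Cmp C S P S j (Cmp C S P P e b)) (Cmp C S P S j (Cmp C S X P i p))"
  have [simp]: "e' \<in> Hom C S S" by (simp add: e'_def)
  have e'a: "Cmp C X S S e' a = Cmp C X P S j i" and e'j: "Cmp C P S S e' j = Cmp C P P S j e"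
    by (simp_all add: e'_def cmp_add_left)
  have pow_j: "Cmp C P S S (mor_pow C S e' k) j = Cmp C P P S j (mor_pow C P e k)" for k
    using pow_intertwine[of P S j e e' k] e'j by simp
  have pow_a: "Cmp C X S S (mor_pow C S e' (Suc k)) a = Cmp C X P S j (Cmp C X P P (mor_pow C P e k) i)"
    for k
    by (simp add: pow_Suc e'a cmp_rewrite_prefix[OF pow_j])
  have "mor_pow C S e' (Suc (Suc l)) = zero_mor C S S"
  proof (rule biproduct_source_eqI[OF bip])
    show "Cmp C X S S (mor_pow C S e' (Suc (Suc l))) a = Cmp C X S S (zero_mor C S S) a"
      by (simp only: pow_a nil) simp
    show "Cmp C P S S (mor_pow C S e' (Suc (Suc l))) j = Cmp C P S S (zero_mor C S S) j"
      by (simp only: pow_j pow_Suc[of P e "Suc l"] nil) simp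
  qed simp_all
  moreover have low': "Cmp C X S X (Cmp C S P X q b) (Cmp C X S S (mor_pow C S e' k) a) = zero_mor C X X"
    if "k < Suc l" for k
    using that by (cases k) (simp_all add: pow_a low)
  moreover have top': "Cmp C X S X (Cmp C S P X q b) (Cmp C X S S (mor_pow C S e' (Suc l)) a) = Idm C X"
    by (simp add: pow_a top)
  moreover have "homotopy_sum C (Suc (Suc l)) (S, e') (S, e') (Cmp C S X S a (Cmp C S P X q b)) = Idm C S"
    (is "?N = _")
  proof (rule biproduct_source_eqI[OF bip])
    define t where "t k = Cmp C S S S (mor_pow C S e' (Suc l - k))
      (Cmp C S S S (Cmp C S X S a (Cmp C S P X q b)) (mor_pow C S e' k))" for k
    have [simp]: "t k \<in> Hom C S S" for k by (simp add: t_def)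
    have N: "?N = finprod (HomG C S S) t {..Suc l}"
      by (simp add: homotopy_sum_def t_def[abs_def] lessThan_Suc_atMost)
    have ta: "Cmp C X S S (t k) a = zero_mor C X S" if "k \<le> l" for k
      using low'[of k] that by (simp add: t_def)
    have ta_top: "Cmp C X S S (t (Suc l)) a = a"
      using top' by (simp add: t_def)
    have "Cmp C X S S ?N a = finprod (HomG C X S) (\<lambda>k. Cmp C X S S (t k) a) {..Suc l}"
      unfolding N by (rule cmp_sum_left) simp_all
    also have "\<dots> = a"
      by (subst sum_single[of _ _ _ "Suc l"]) (simp_all add: ta ta_top)
    finally show "Cmp C X S S ?N a = Cmp C X S S (Idm C S) a" by simp
    have tj: "Cmp C P S S (t k) j = Cmp C P P S j (Cmp C P P P (mor_pow C P e (l - k))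
        (Cmp C P P P (Cmp C P X P i q) (mor_pow C P e k)))" if "k \<le> l" for k
      using that by (simp add: t_def pow_j Suc_diff_le cmp_rewrite_prefix[OF pow_a])
    have tj_top: "Cmp C P S S (t (Suc l)) j = zero_mor C P S"
      by (simp add: t_def pow_j nil)
    have "Cmp C P S S ?N j = finprod (HomG C P S) (\<lambda>k. Cmp C P S S (t k) j) {..Suc l}"
      unfolding N by (rule cmp_sum_left) simp_all
    also have "\<dots> = finprod (HomG C P S) (\<lambda>k. Cmp C P S S (t k) j) {..l}"
      by (subst sum_atMost_Suc) (simp_all add: tj_top sum_closed)
    also have "\<dots> = Cmp C P P S j (homotopy_sum C (Suc l) (P, e) (P, e) (Cmp C P X P i q))"
      unfolding homotopy_sum_def lessThan_Suc_atMost fst_conv snd_conv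
      by (subst cmp_sum_right, simp_all, rule sum_cong) (simp_all add: tj)
    finally show "Cmp C P S S ?N j = Cmp C P S S (Idm C S) j"
      by (simp add: sum)
  qed (simp_all add: homotopy_sum_def sum_closed)
  ultimately show ?case
    by (intro exI[of _ S] exI[of _ e'] exI[of _ a] exI[of _ "Cmp C S P X q b"]) simp
qed


section \<open>Contractible objects\<close>

text \<open>
  Contractible objects are the zero objects of the homotopy category.
\<close>

definition contractible :: "('o, 'm) addcat \<Rightarrow> nat \<Rightarrow> 'o \<times> 'm \<Rightarrow> bool"
  where "contractible C n A \<longleftrightarrow> A \<in> Obj (diff_category C n) \<and>
    Idm C (fst A) \<in> null_homotopic C n A A"

context nilpotent_differentials
begin

lemma contractibleE:
  assumes "contractible C n A"
  obtains s where "A \<in> Obj D" "s \<in> Hom C (fst A) (fst A)" "homotopy_sum C n A A s = Idm C (fst A)"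
  using assms unfolding contractible_def null_homotopic_iff by metis

lemma contractibleI:
  assumes "A \<in> Obj D" "s \<in> Hom C (fst A) (fst A)" "homotopy_sum C n A A s = Idm C (fst A)"
  shows "contractible C n A"
  using assms homotopy_sum_in_diff[of A A s] unfolding contractible_def null_homotopic_iff by metis

text \<open>
  A lift of \<open>f\<close> in \<open>C\<close> is \<open>t \<circ> f\<close>; the homotopy sum of \<open>t \<circ> f \<circ> s\<close> turns it into a morphism of
  differential objects, as averaging does in Maschke's theorem.
\<close>

lemma contractible_projective:
  assumes "contractible C n P"
  shows "projective D E P"
  unfolding projective_def
proof (intro conjI allI impI ballI)
  obtain s where P: "P \<in> Obj D" and s [simp]: "s \<in> Hom C (fst P) (fst P)"
    and one: "homotopy_sum C n P P s = Idm C (fst P)"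
    using assms by (rule contractibleE)
  show "P \<in> Obj D" by (rule P)
  fix B W p f
  assume "deflation E B W p" and f: "f \<in> Hom D P W"
  then obtain t where B: "B \<in> Obj D" and W: "W \<in> Obj D" and p: "p \<in> Hom D B W"
    and t [simp]: "t \<in> Hom C (fst W) (fst B)"
    and pt: "Cmp C (fst W) (fst B) (fst W) p t = Idm C (fst W)"
    unfolding deflation_iff_split_epi by blast
  note [simp] = diff_ObjD(1)[OF P] diff_ObjD(1)[OF B] diff_ObjD(1)[OF W]
    diff_HomD(1)[OF p] diff_HomD(1)[OF f] cmp_rewrite_prefix[OF pt]
  let ?g = "homotopy_sum C n P B (Cmp C (fst P) (fst W) (fst B) t (Cmp C (fst P) (fst P) (fst W) f s))"
  have "?g \<in> Hom D P B"
    by (rule homotopy_sum_in_diff[OF P B]) simp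
  moreover have "Cmp D P B W p ?g = f"
    using cmp_homotopy_sum_right[OF P P W s f] by (simp add: cmp_homotopy_sum_right[OF P B W _ p] one)
  ultimately show "\<exists>g\<in>Hom D P B. Cmp D P B W p g = f" by blast
qed

lemma contractible_injective:
  assumes "contractible C n I"
  shows "injective D E I"
  unfolding injective_def
proof (intro conjI allI impI ballI)
  obtain s where I: "I \<in> Obj D" and s [simp]: "s \<in> Hom C (fst I) (fst I)"
    and one: "homotopy_sum C n I I s = Idm C (fst I)"
    using assms by (rule contractibleE)
  show "I \<in> Obj D" by (rule I)
  fix A B i f
  assume "inflation E A B i" and f: "f \<in> Hom D A I"
  then obtain r where A: "A \<in> Obj D" and B: "B \<in> Obj D" and i: "i \<in> Hom D A B"
    and r [simp]: "r \<in> Hom C (fst B) (fst A)"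
    and ri [simp]: "Cmp C (fst A) (fst B) (fst A) r i = Idm C (fst A)"
    unfolding inflation_iff_split_mono by blast
  note [simp] = diff_ObjD(1)[OF A] diff_ObjD(1)[OF B] diff_ObjD(1)[OF I]
    diff_HomD(1)[OF i] diff_HomD(1)[OF f]
  let ?g = "homotopy_sum C n B I (Cmp C (fst B) (fst I) (fst I) s (Cmp C (fst B) (fst A) (fst I) f r))"
  have "?g \<in> Hom D B I"
    by (rule homotopy_sum_in_diff[OF B I]) simp
  moreover have "Cmp D A B I ?g i = f"
    using cmp_homotopy_sum_left[OF I A I s f] by (simp add: cmp_homotopy_sum_left[OF B A I _ i] one)
  ultimately show "\<exists>g\<in>Hom D B I. Cmp D A B I g i = f" by blast
qed

text \<open>
  The truncated polynomial object \<open>P\<close> on \<open>A\<close> is free and cofree over the forgetful functor. The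
  deflation \<open>P \<rightarrow> A\<close> evaluates polynomials at the differential of \<open>A\<close>, and the inclusion \<open>j\<close> of
  constants is its section in \<open>C\<close>; dually the top coefficient \<open>q\<close> is a retraction of the inflation.
  Both morphisms are homotopy sums, which makes them commute with the differentials.
\<close>

lemma contractible_cover_and_hull:
  assumes A: "A \<in> Obj D"
  obtains P p i where "contractible C n P" "deflation E P A p" "inflation E A P i"
proof -
  obtain l where n: "n = Suc l" using n_pos by (cases n) auto
  note [simp] = diff_ObjD(1,2)[OF A]
  obtain P \<epsilon> j q where [simp]: "P \<in> Obj C" "\<epsilon> \<in> Hom C P P" "j \<in> Hom C (fst A) P" "q \<in> Hom C P (fst A)"
    and nil: "mor_pow C P \<epsilon> (Suc l) = zero_mor C P P"
    and low: "\<And>k. k < l \<Longrightarrow>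
      Cmp C (fst A) P (fst A) q (Cmp C (fst A) P P (mor_pow C P \<epsilon> k) j) = zero_mor C (fst A) (fst A)"
    and top: "Cmp C (fst A) P (fst A) q (Cmp C (fst A) P P (mor_pow C P \<epsilon> l) j) = Idm C (fst A)"
    and sum: "homotopy_sum C (Suc l) (P, \<epsilon>) (P, \<epsilon>) (Cmp C P (fst A) P j q) = Idm C P"
    using truncated_polynomial_object[of "fst A" l] by auto
  have P: "(P, \<epsilon>) \<in> Obj D" using nil by (simp add: diff_Obj_iff n)
  have contr: "contractible C n (P, \<epsilon>)"
    using sum by (intro contractibleI[OF P, of "Cmp C P (fst A) P j q"]) (simp_all add: n)
  let ?p = "homotopy_sum C n (P, \<epsilon>) A q" and ?i = "homotopy_sum C n A (P, \<epsilon>) j"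
  have "Cmp C (fst A) P (fst A) ?p j = finprod (HomG C (fst A) (fst A))
      (\<lambda>k. Cmp C (fst A) (fst A) (fst A) (mor_pow C (fst A) (snd A) (l - k))
        (Cmp C (fst A) P (fst A) q (Cmp C (fst A) P P (mor_pow C P \<epsilon> k) j))) {..l}"
    unfolding homotopy_sum_def n lessThan_Suc_atMost by (simp, subst cmp_sum_left) simp_all
  also have "\<dots> = Idm C (fst A)"
    by (subst sum_single[of _ _ _ l]) (simp_all add: low top)
  finally have defl: "deflation E (P, \<epsilon>) A ?p"
    unfolding deflation_iff_split_epi using homotopy_sum_in_diff[OF P A, of q] P A
    by (auto intro!: bexI[of _ j])
  have "Cmp C (fst A) P (fst A) q ?i = finprod (HomG C (fst A) (fst A))
      (\<lambda>k. Cmp C (fst A) (fst A) (fst A)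
        (Cmp C (fst A) P (fst A) q (Cmp C (fst A) P P (mor_pow C P \<epsilon> (l - k)) j))
        (mor_pow C (fst A) (snd A) k)) {..l}"
    unfolding homotopy_sum_def n lessThan_Suc_atMost by (simp, subst cmp_sum_right) simp_all
  also have "\<dots> = Idm C (fst A)"
    by (subst sum_single[of _ _ _ 0]) (simp_all add: low top del: cmp_assoc)
  finally have infl: "inflation E A (P, \<epsilon>) ?i"
    unfolding inflation_iff_split_mono using homotopy_sum_in_diff[OF A P, of j] P A
    by (auto intro!: bexI[of _ q])
  show ?thesis by (rule that[OF contr defl infl])
qed

text \<open>
  By naturality, \<open>1 = \<rho> N(s) \<sigma> = N(\<rho> s \<sigma>)\<close>.
\<close>

lemma contractible_retract:
  assumes Q: "contractible C n Q" and P: "P \<in> Obj D" and \<sigma>: "\<sigma> \<in> Hom D P Q" and \<rho>: "\<rho> \<in> Hom D Q P"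
    and retract: "Cmp C (fst P) (fst Q) (fst P) \<rho> \<sigma> = Idm C (fst P)"
  shows "contractible C n P"
proof -
  obtain s where QD: "Q \<in> Obj D" and s [simp]: "s \<in> Hom C (fst Q) (fst Q)"
    and one: "homotopy_sum C n Q Q s = Idm C (fst Q)"
    using Q by (rule contractibleE)
  note [simp] = diff_ObjD(1)[OF P] diff_ObjD(1)[OF QD] diff_HomD(1)[OF \<sigma>] diff_HomD(1)[OF \<rho>]
  have "homotopy_sum C n P P (Cmp C (fst P) (fst Q) (fst P) \<rho> (Cmp C (fst P) (fst Q) (fst Q) s \<sigma>))
      = Idm C (fst P)"
    by (simp add: retract one cmp_homotopy_sum_right[OF P QD P _ \<rho>, symmetric]
      cmp_homotopy_sum_left[OF QD P QD s \<sigma>, symmetric])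
  then show ?thesis
    by (rule contractibleI[OF P, rotated]) simp
qed

lemma projective_iff_contractible: "projective D E P \<longleftrightarrow> contractible C n P"
proof
  assume proj: "projective D E P"
  then have P: "P \<in> Obj D" by (simp add: projective_def)
  obtain Q p where Q: "contractible C n Q" and defl: "deflation E Q P p"
    using contractible_cover_and_hull[OF P] by blast
  have p: "p \<in> Hom D Q P" using defl by (simp add: deflation_iff_split_epi)
  have "Idm D P \<in> Hom D P P"
    by (rule additive_category.id_closed[OF diff_additive P])
  then obtain \<sigma> where "\<sigma> \<in> Hom D P Q" "Cmp D P Q P p \<sigma> = Idm D P"
    using proj defl unfolding projective_def by blast
  then show "contractible C n P"
    using contractible_retract[OF Q P _ p] by simp
qed (rule contractible_projective)

lemma injective_iff_contractible: "injective D E I \<longleftrightarrow> contractible C n I"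
proof
  assume inj: "injective D E I"
  then have I: "I \<in> Obj D" by (simp add: injective_def)
  obtain Q i where Q: "contractible C n Q" and infl: "inflation E I Q i"
    using contractible_cover_and_hull[OF I] by blast
  have i: "i \<in> Hom D I Q" using infl by (simp add: inflation_iff_split_mono)
  have "Idm D I \<in> Hom D I I"
    by (rule additive_category.id_closed[OF diff_additive I])
  then obtain \<rho> where "\<rho> \<in> Hom D Q I" "Cmp D I Q I \<rho> i = Idm D I"
    using inj infl unfolding injective_def by blast
  then show "contractible C n I"
    using contractible_retract[OF Q I i] by simp
qed (rule contractible_injective)

lemma diff_frobenius: "frobenius_category D E"
proof (rule frobenius_category.intro[OF diff_exact], rule frobenius_category_axioms.intro)
  show "\<exists>P p. projective D E P \<and> deflation E P X p" if "X \<in> Obj D" for X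
    using contractible_cover_and_hull[OF that] contractible_projective by metis
  show "\<exists>I i. injective D E I \<and> inflation E X I i" if "X \<in> Obj D" for X
    using contractible_cover_and_hull[OF that] contractible_injective by metis
  show "projective D E P \<longleftrightarrow> injective D E P" for P
    by (simp add: projective_iff_contractible injective_iff_contractible)
qed


section \<open>Homotopy as factorization through a projective object\<close>

text \<open>
  Naturality of homotopy sums gives both inclusions: \<open>h N(s) g = N(h s g)\<close> if \<open>N(s)\<close> is the identity of
  the projective object, and \<open>N(s) = N(s r) i\<close> if \<open>i\<close> is an inflation into a contractible object with
  retraction \<open>r\<close> in \<open>C\<close>.
\<close>

lemma through_projective_eq_null_homotopic:
  assumes A: "A \<in> Obj D" and B: "B \<in> Obj D"
  shows "through_projective D E A B = null_homotopic C n A B"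
proof (rule subset_antisym; rule subsetI)
  note [simp] = diff_ObjD(1)[OF A] diff_ObjD(1)[OF B]
  fix f assume "f \<in> through_projective D E A B"
  then obtain P g h where f: "f \<in> Hom D A B" and proj: "projective D E P"
    and g: "g \<in> Hom D A P" and h: "h \<in> Hom D P B" and fhg: "f = Cmp D A P B h g"
    unfolding through_projective_def by blast
  obtain s where P: "P \<in> Obj D" and s [simp]: "s \<in> Hom C (fst P) (fst P)"
    and one: "homotopy_sum C n P P s = Idm C (fst P)"
    using proj unfolding projective_iff_contractible by (rule contractibleE)
  note [simp] = diff_ObjD(1)[OF P] diff_HomD(1)[OF g] diff_HomD(1)[OF h]
  have "homotopy_sum C n A B (Cmp C (fst A) (fst P) (fst B) h (Cmp C (fst A) (fst P) (fst P) s g)) = f"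
    by (simp add: one fhg cmp_homotopy_sum_right[OF A P B _ h, symmetric]
      cmp_homotopy_sum_left[OF P A P s g, symmetric])
  then show "f \<in> null_homotopic C n A B"
    unfolding null_homotopic_iff using f
    by (intro conjI bexI[of _ "Cmp C (fst A) (fst P) (fst B) h (Cmp C (fst A) (fst P) (fst P) s g)"])
      simp_all
next
  note [simp] = diff_ObjD(1)[OF A] diff_ObjD(1)[OF B]
  fix f assume "f \<in> null_homotopic C n A B"
  then obtain s where f: "f \<in> Hom D A B" and s [simp]: "s \<in> Hom C (fst A) (fst B)"
    and fs: "f = homotopy_sum C n A B s"
    unfolding null_homotopic_iff by blast
  obtain P i where contr: "contractible C n P" and "inflation E A P i"
    using contractible_cover_and_hull[OF A] by blast
  then obtain r where P: "P \<in> Obj D" and i: "i \<in> Hom D A P" and r [simp]: "r \<in> Hom C (fst P) (fst A)"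
    and ri [simp]: "Cmp C (fst A) (fst P) (fst A) r i = Idm C (fst A)"
    unfolding inflation_iff_split_mono by blast
  note [simp] = diff_ObjD(1)[OF P] diff_HomD(1)[OF i]
  let ?h = "homotopy_sum C n P B (Cmp C (fst P) (fst A) (fst B) s r)"
  have "f = Cmp D A P B ?h i"
    by (simp add: fs cmp_homotopy_sum_left[OF P A B _ i])
  moreover have "?h \<in> Hom D P B"
    by (rule homotopy_sum_in_diff[OF P B]) simp
  ultimately show "f \<in> through_projective D E A B"
    using f i contractible_projective[OF contr] unfolding through_projective_def by blast
qed

end

lemma quotient_category_cong:
  assumes "\<And>X Y. \<lbrakk>X \<in> Obj C; Y \<in> Obj C\<rbrakk> \<Longrightarrow> N X Y = N' X Y"
  shows "quotient_category C N = quotient_category C N'"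
  using assms by (simp add: quotient_category_def restrict_def fun_eq_iff)

theorem theorem4p7:
  fixes C :: "('o, 'm) addcat" and n :: nat
  assumes "n \<ge> 2"
    and "additive_category C"
    and "idempotent_complete C"
  shows "frobenius_category (diff_category C n) (lifted_pairs C n (split_pairs C)) \<and>
    stable_category (diff_category C n) (lifted_pairs C n (split_pairs C)) = homotopy_category C n"
proof -
  interpret nilpotent_differentials C n
    using assms by (simp add: nilpotent_differentials_def nilpotent_differentials_axioms_def)
  show ?thesis
    unfolding stable_category_def homotopy_category_def
    by (intro conjI diff_frobenius quotient_category_cong through_projective_eq_null_homotopic)
qed

end
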